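(* Let $(\Sigma,\partial)$ be a differential field of characteristic zero whose field of constants $C$ is algebraically closed, let $u_s\in\Sigma\setminus C$, and let $L_s=-\partial^2+u_s\in\Sigma[\partial]$. The following statements are equivalent (the integer $s\ge 0$ being the same in 2 and 3): 1. $L_s$ is algebro-geometric. 2. There exist an integer $s$ and a unique monic operator $A_{2s+1}$ of minimal order $2s+1$ such that $\mathcal{C}(L_s)=C[L_s,A_{2s+1}]$ and $A_{2s+1}^2+R_{2s+1}(L_s)=0$, with $R_{2s+1}(\lambda)\in C[\lambda]$ of degree $2s+1$. 3. There is an integer $s$ such that $u_s$ is a KdV-potential of KdV level $s$.
   Context: $\Sigma[\partial]$ is the ring of differential operators with coefficients in $\Sigma$, with $\partial a-a\partial=\partial(a)$ for $a\in\Sigma$. An operator $L\in\Sigma[\partial]\setminus C[\partial]$ of order $n$ is called algebro-geometric if there is an operator $P\in\Sigma[\partial]$ of order relatively prime to $n$ such that $[L,P]=LP-PL=0$. $\mathcal{C}(L_s)$ denotes the centralizer of $L_s$ in $\Sigma[\partial]$, and $C[L_s,A_{2s+1}]$ the $C$-algebra generated by $L_s$ and $A_{2s+1}$. "Minimal order" means minimal among the operators in $\mathcal{C}(L_s)$ that are not in $C[L_s]$. KdV hierarchy. Let $u$ be a differential indeterminate over $C$, with $C\{u\}=C[u,u',u'',\dots]$ the ring of differential polynomials. Put $\mathcal{R}=-\frac14\partial^2+u+\frac12u'\partial^{-1}$ and $\mathcal{R}^*=-\frac14\partial^2+u-\frac12\partial^{-1}u'$, where $\partial^{-1}$ is the inverse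 of $\partial$ (applied to an element of $\partial(C\{u\})$ it gives the antiderivative without constant term). Define $v_0=1$, $v_n=\mathcal{R}^*(v_{n-1})$ and $\mathrm{kdv}_0=u'$, $\mathrm{kdv}_n=\mathcal{R}(\mathrm{kdv}_{n-1})$ for $n\ge1$; these are differential polynomials in $C\{u\}$ and $2\partial(v_{n+1})=\mathrm{kdv}_n$. For ${\bf c}^s=(c_1^s,\dots,c_s^s)\in C^s$ put $\mathrm{KdV}_s(u,{\bf c}^s)=\mathrm{kdv}_s(u)+c_1^s\,\mathrm{kdv}_{s-1}(u)+\cdots+c_s^s\,\mathrm{kdv}_0(u)$. An element $w\in\Sigma$ is a KdV-potential of KdV level $s$ if $\mathrm{KdV}_s(w,{\bf c}^s)=0$ for some ${\bf c}^s\in C^s$ and $s$ is minimal with this property. *)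

theory Defs
  imports "HOL-Computational_Algebra.Polynomial" "HOL-Library.Poly_Mapping"
begin

class differential_field = field +
  fixes der :: "'a \<Rightarrow> 'a"
  assumes der_add: "der (a + b) = der a + der b"
    and der_mult: "der (a * b) = der a * b + a * der b"
begin

lemma der_0 [simp]: "der 0 = 0"
  using der_add [of 0 0] by simp

lemma der_1 [simp]: "der 1 = 0"
  using der_mult [of 1 1] by simp

lemma der_uminus: "der (- a) = - der a"
  using der_add [of "- a" a] by (simp add: eq_neg_iff_add_eq_0)

lemma der_diff: "der (a - b) = der a - der b"
  using der_add [of a "- b"] der_uminus [of b] by simp

lemma der_inverse_constant:
  assumes "der a = 0"
  shows "der (inverse a) = 0"
proof (cases "a = 0")
  case False
  have "a * der (inverse a) = der (a * inverse a)"
    by (simp only: der_mult assms mult_zero_left add_0_left)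
  also have "\<dots> = 0" using False by simp
  finally show ?thesis using False by simp
qed (use assms in simp)

definition constants :: "'a set" where
  "constants = {a. der a = 0}"

end

text \<open>The field of constants as a type, so that the library's polynomials can be taken over it.\<close>

typedef (overloaded) 'a const = "constants :: 'a::differential_field set"
  morphisms of_const Abs_const
  by (rule exI [of _ 0]) (simp add: constants_def)

setup_lifting type_definition_const

instantiation const :: (differential_field) field
begin
lift_definition zero_const :: "'a const" is 0 by (simp add: constants_def)
lift_definition one_const :: "'a const" is 1 by (simp add: constants_def)
lift_definition plus_const :: "'a const \<Rightarrow> 'a const \<Rightarrow> 'a const" is "(+)"
  by (simp add: constants_def der_add)
lift_definition uminus_const :: "'a const \<Rightarrow> 'a const" is uminus
  by (simp add: constants_def der_uminus)
lift_definition minus_const :: "'a const \<Rightarrow> 'a const \<Rightarrow> 'a const" is "(-)"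
  by (simp add: constants_def der_diff)
lift_definition times_const :: "'a const \<Rightarrow> 'a const \<Rightarrow> 'a const" is "(*)"
  by (simp add: constants_def der_mult)
lift_definition inverse_const :: "'a const \<Rightarrow> 'a const" is inverse
  by (simp add: constants_def der_inverse_constant)
lift_definition divide_const :: "'a const \<Rightarrow> 'a const \<Rightarrow> 'a const" is "(/)"
  by (simp add: constants_def der_inverse_constant der_mult divide_inverse)
instance
proof
  fix a b c :: "'a const"
  show "a * b * c = a * (b * c)" by transfer (rule mult.assoc)
  show "a * b = b * a" by transfer (rule mult.commute)
  show "1 * a = a" by transfer simp
  show "a + b + c = a + (b + c)" by transfer (rule add.assoc)
  show "a + b = b + a" by transfer (rule add.commute)
  show "0 + a = a" by transfer simp
  show "- a + a = 0" by transfer simp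
  show "a - b = a + - b" by transfer simp
  show "(a + b) * c = a * c + b * c" by transfer (rule distrib_right)
  show "0 \<noteq> (1 :: 'a const)" by transfer simp
  show "a \<noteq> 0 \<Longrightarrow> inverse a * a = 1" by transfer simp
  show "a div b = a * inverse b" by transfer (rule divide_inverse)
  show "inverse 0 = (0 :: 'a const)" by transfer simp
qed

end

lemma of_const_of_nat [simp]: "of_const (of_nat n) = of_nat n"
  by (induction n) (simp_all add: zero_const.rep_eq one_const.rep_eq plus_const.rep_eq)

instance const :: ("{differential_field, field_char_0}") field_char_0
  by standard (metis injI of_const_of_nat of_nat_eq_iff)

text \<open>The operator \<open>a\<^sub>0 + a\<^sub>1 \<partial> + \<dots> + a\<^sub>n \<partial>\<^sup>n\<close>, with the coefficients on the left, is stored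
  as the polynomial with the coefficients \<open>a\<^sub>0, \<dots>, a\<^sub>n\<close>.\<close>

typedef (overloaded) 'a::differential_field diffop = "UNIV :: 'a poly set"
  morphisms op_poly Diffop ..

setup_lifting type_definition_diffop

text \<open>Left multiplication by \<open>\<partial>\<close>, from \<open>\<partial> b = b \<partial> + b'\<close>.\<close>

definition del_left :: "'a::differential_field poly \<Rightarrow> 'a poly" where
  "del_left q = map_poly der q + pCons 0 q"

definition op_times :: "'a::differential_field poly \<Rightarrow> 'a poly \<Rightarrow> 'a poly" where
  "op_times p q = (\<Sum>i\<le>degree p. smult (coeff p i) ((del_left ^^ i) q))"

lemma coeff_map_der [simp]: "coeff (map_poly der q) n = der (coeff q n)"
  by (simp add: coeff_map_poly)

lemma del_left_0 [simp]: "del_left 0 = 0"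
  by (simp add: del_left_def)

lemma del_left_add: "del_left (p + q) = del_left p + del_left q"
  by (simp add: del_left_def poly_eq_iff der_add coeff_pCons split: nat.split)

lemma del_left_smult: "del_left (smult a q) = smult (der a) q + smult a (del_left q)"
  by (simp add: del_left_def poly_eq_iff der_mult coeff_pCons algebra_simps split: nat.split)

lemma op_times_0 [simp]: "op_times 0 q = 0"
  by (simp add: op_times_def)

lemma op_times_pCons: "op_times (pCons a p) q = smult a q + op_times p (del_left q)"
proof (cases "p = 0")
  case True
  then show ?thesis by (simp add: op_times_def)
next
  case False
  then show ?thesis
    by (simp add: op_times_def sum.atMost_Suc_shift funpow_swap1 del: sum.atMost_Suc)
qed

lemma op_times_0_right [simp]: "op_times p 0 = 0"
  by (induction p) (simp_all add: op_times_pCons)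

lemma op_times_add_right: "op_times p (q + r) = op_times p q + op_times p r"
  by (induction p arbitrary: q r)
    (simp_all add: op_times_pCons smult_add_right del_left_add algebra_simps)

lemma op_times_add_left: "op_times (p + q) r = op_times p r + op_times q r"
proof (induction p arbitrary: q r)
  case (pCons a p)
  obtain b q' where "q = pCons b q'" by (rule pCons_cases)
  then show ?case
    by (simp add: op_times_pCons pCons.IH smult_add_left algebra_simps)
qed simp

lemma op_times_smult_left: "op_times (smult a p) q = smult a (op_times p q)"
  by (induction p arbitrary: q) (simp_all add: op_times_pCons smult_add_right)

lemma op_times_1_left: "op_times [:1:] q = q"
  by (simp add: op_times_pCons)

lemma op_times_del_left: "op_times (del_left p) q = del_left (op_times p q)"
proof (induction p arbitrary: q)
  case (pCons a p)
  have "op_times (del_left (pCons a p)) q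
      = op_times (pCons (der a) (map_poly der p) + pCons 0 (pCons a p)) q"
    by (simp add: del_left_def map_poly_pCons)
  also have "\<dots> = smult (der a) q + op_times (map_poly der p) (del_left q)
      + smult a (del_left q) + op_times p (del_left (del_left q))"
    by (simp add: op_times_add_left op_times_pCons)
  also have "\<dots> = smult (der a) q + smult a (del_left q) + op_times (del_left p) (del_left q)"
    by (simp add: del_left_def [of p] op_times_add_left op_times_pCons)
  finally show ?case
    by (simp add: pCons.IH op_times_pCons del_left_add del_left_smult)
qed simp

lemma op_times_assoc: "op_times (op_times p q) r = op_times p (op_times q r)"
  by (induction p arbitrary: q)
    (simp_all add: op_times_pCons op_times_add_left op_times_smult_left op_times_del_left)

lemma op_times_1_right: "op_times p [:1:] = p"
proof -
  have "op_times p (monom 1 n) = p * monom 1 n" for n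
  proof (induction p arbitrary: n)
    case (pCons a p)
    have "del_left (monom 1 n :: 'a poly) = monom 1 (Suc n)"
      by (simp add: del_left_def poly_eq_iff coeff_pCons split: nat.split)
    then show ?case
      by (simp add: op_times_pCons pCons.IH) (simp add: monom_Suc)
  qed simp
  from this [of 0] show ?thesis by (simp add: monom_0)
qed

instantiation diffop :: (differential_field) ring_1
begin
lift_definition zero_diffop :: "'a diffop" is 0 .
lift_definition one_diffop :: "'a diffop" is "[:1:]" .
lift_definition plus_diffop :: "'a diffop \<Rightarrow> 'a diffop \<Rightarrow> 'a diffop" is "(+)" .
lift_definition uminus_diffop :: "'a diffop \<Rightarrow> 'a diffop" is uminus .
lift_definition minus_diffop :: "'a diffop \<Rightarrow> 'a diffop \<Rightarrow> 'a diffop" is "(-)" .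
lift_definition times_diffop :: "'a diffop \<Rightarrow> 'a diffop \<Rightarrow> 'a diffop" is op_times .
instance proof
  fix a b c :: "'a diffop"
  show "a * b * c = a * (b * c)" by transfer (rule op_times_assoc)
  show "1 * a = a" by transfer (rule op_times_1_left)
  show "a * 1 = a" by transfer (rule op_times_1_right)
  show "a + b + c = a + (b + c)" by transfer (rule add.assoc)
  show "a + b = b + a" by transfer (rule add.commute)
  show "0 + a = a" by transfer simp
  show "- a + a = 0" by transfer simp
  show "a - b = a + - b" by transfer simp
  show "(a + b) * c = a * c + b * c" by transfer (rule op_times_add_left)
  show "a * (b + c) = a * b + a * c" by transfer (rule op_times_add_right)
  show "0 \<noteq> (1 :: 'a diffop)" by transfer simp
qed

end

lift_definition op_scalar :: "'a::differential_field \<Rightarrow> 'a diffop" is "\<lambda>a. [:a:]" .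

lift_definition op_del :: "'a::differential_field diffop" (\<open>\<partial>\<close>) is "[:0, 1:]" .

lemma del_commutation: "\<partial> * op_scalar a - op_scalar a * \<partial> = op_scalar (der a)"
  by transfer (simp add: op_times_pCons del_left_def map_poly_pCons)

definition op_coeff :: "'a::differential_field diffop \<Rightarrow> nat \<Rightarrow> 'a" where
  "op_coeff P n = coeff (op_poly P) n"

text \<open>As for \<open>degree\<close>, the order of the zero operator is \<open>0\<close> by convention.\<close>

definition op_order :: "'a::differential_field diffop \<Rightarrow> nat" where
  "op_order P = degree (op_poly P)"

definition op_monic :: "'a::differential_field diffop \<Rightarrow> bool" where
  "op_monic P \<longleftrightarrow> op_coeff P (op_order P) = 1"

definition constant_coeff_ops :: "'a::differential_field diffop set" where
  "constant_coeff_ops = {P. \<forall>n. op_coeff P n \<in> constants}"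

definition algebro_geometric :: "'a::differential_field diffop \<Rightarrow> bool" where
  "algebro_geometric L \<longleftrightarrow> L \<notin> constant_coeff_ops \<and>
    (\<exists>P. P \<noteq> 0 \<and> coprime (op_order P) (op_order L) \<and> L * P - P * L = 0)"

definition centralizer :: "'a::differential_field diffop \<Rightarrow> 'a diffop set" where
  "centralizer L = {P. L * P = P * L}"

inductive_set constant_algebra ::
    "'a::differential_field diffop set \<Rightarrow> 'a diffop set" for S where
  scalar: "op_scalar (of_const c) \<in> constant_algebra S"
| generator: "P \<in> S \<Longrightarrow> P \<in> constant_algebra S"
| add: "P \<in> constant_algebra S \<Longrightarrow> Q \<in> constant_algebra S \<Longrightarrow> P + Q \<in> constant_algebra S"
| mult: "P \<in> constant_algebra S \<Longrightarrow> Q \<in> constant_algebra S \<Longrightarrow> P * Q \<in> constant_algebra S"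

definition poly_at_op :: "'a::differential_field const poly \<Rightarrow> 'a diffop \<Rightarrow> 'a diffop" where
  "poly_at_op R L = (\<Sum>i\<le>degree R. op_scalar (of_const (coeff R i)) * L ^ i)"

definition schroedinger :: "'a::differential_field \<Rightarrow> 'a diffop" where
  "schroedinger u = - (\<partial> ^ 2) + op_scalar u"

definition minimal_order_in_centralizer ::
    "'a::differential_field diffop \<Rightarrow> 'a diffop \<Rightarrow> bool" where
  "minimal_order_in_centralizer L A \<longleftrightarrow>
    A \<in> centralizer L - constant_algebra {L} \<and>
    (\<forall>B \<in> centralizer L - constant_algebra {L}. op_order A \<le> op_order B)"

definition basic_operator :: "'a::differential_field diffop \<Rightarrow> nat \<Rightarrow> 'a diffop \<Rightarrow> bool" where
  "basic_operator L s A \<longleftrightarrow> op_monic A \<and> op_order A = 2 * s + 1 \<and>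
    minimal_order_in_centralizer L A \<and>
    centralizer L = constant_algebra {L, A} \<and>
    (\<exists>R. degree R = 2 * s + 1 \<and> A ^ 2 + poly_at_op R L = 0)"

text \<open>The ring of differential polynomials in \<open>u\<close>: polynomials in the variables
  \<open>u, u', u'', \<dots>\<close>, where a monomial maps \<open>k\<close> to the exponent of the \<open>k\<close>-th derivative.\<close>

type_synonym 'c diffpoly = "(nat \<Rightarrow>\<^sub>0 nat) \<Rightarrow>\<^sub>0 'c"

definition dp_const :: "'c::zero \<Rightarrow> 'c diffpoly" where
  "dp_const c = Poly_Mapping.single 0 c"

definition dp_var :: "nat \<Rightarrow> 'c::zero_neq_one diffpoly" where
  "dp_var k = Poly_Mapping.single (Poly_Mapping.single k 1) 1"

text \<open>The derivation that vanishes on constants and maps \<open>dp_var k\<close> to \<open>dp_var (k + 1)\<close>: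
  on a monomial, for each \<open>k\<close>, one factor \<open>dp_var k\<close> is replaced by \<open>dp_var (k + 1)\<close>.\<close>

definition dp_der :: "'c::comm_ring_1 diffpoly \<Rightarrow> 'c diffpoly" where
  "dp_der p = (\<Sum>m\<in>Poly_Mapping.keys p. \<Sum>k\<in>Poly_Mapping.keys m.
     Poly_Mapping.single (m - Poly_Mapping.single k 1 + Poly_Mapping.single (Suc k) 1)
       (Poly_Mapping.lookup p m * of_nat (Poly_Mapping.lookup m k)))"

text \<open>The antiderivative without constant term; meaningful on the range of \<open>dp_der\<close>.\<close>

definition dp_antider :: "'c::comm_ring_1 diffpoly \<Rightarrow> 'c diffpoly" where
  "dp_antider p = (THE q. dp_der q = p \<and> Poly_Mapping.lookup q 0 = 0)"

fun kdv :: "nat \<Rightarrow> 'c::field diffpoly" where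
  "kdv 0 = dp_var 1"
| "kdv (Suc n) = dp_const (- 1 / 4) * dp_der (dp_der (kdv n)) + dp_var 0 * kdv n
     + dp_const (1 / 2) * dp_var 1 * dp_antider (kdv n)"

text \<open>Only \<open>c 1, \<dots>, c s\<close> are used.\<close>

definition KdV :: "nat \<Rightarrow> (nat \<Rightarrow> 'c) \<Rightarrow> 'c::field diffpoly" where
  "KdV s c = kdv s + (\<Sum>i=1..s. dp_const (c i) * kdv (s - i))"

definition dp_eval :: "'a::differential_field \<Rightarrow> 'a const diffpoly \<Rightarrow> 'a" where
  "dp_eval w p = (\<Sum>m\<in>Poly_Mapping.keys p. of_const (Poly_Mapping.lookup p m) *
     (\<Prod>k\<in>Poly_Mapping.keys m. ((der ^^ k) w) ^ Poly_Mapping.lookup m k))"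

definition KdV_potential :: "'a::differential_field \<Rightarrow> nat \<Rightarrow> bool" where
  "KdV_potential w s \<longleftrightarrow> (\<exists>c. dp_eval w (KdV s c) = 0) \<and>
    (\<forall>t<s. \<not> (\<exists>c. dp_eval w (KdV t c) = 0))"

end

theory Submission
  imports Defs
begin

text \<open>All three statements say that \<open>L = - \<partial>\<^sup>2 + u\<close> commutes with an operator of odd order, and
the level \<open>s\<close> in two of them is the least one for which an operator of order \<open>2 s + 1\<close> commutes with
\<open>L\<close>. Write \<open>odd_commuting_order u s\<close> for the existence of such an operator.

The link with the KdV hierarchy comes from dividing by \<open>L\<close> on the right: every operator is
\<open>P = Q L + a \<partial> + b\<close>, in exactly one way, and
\<open>[L, P] = ([L, Q] + 2 a') L - (a'' + 2 b') \<partial> - (b'' + a u' + 2 a' u)\<close>.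
Suppose that \<open>[L, P]\<close> is a scalar of the form \<open>- 2 f'\<close>. Then \<open>[L, Q] = - 2 a'\<close> is again a scalar,
and eliminating \<open>b\<close> leaves \<open>f' = - a''' / 4 + u a' + u' a / 2\<close>, which is the recursion of the KdV
hierarchy. By induction on the order, \<open>f\<close> is a combination of \<open>v\<^sub>0, v\<^sub>1, \<dots>\<close> with constant
coefficients. For \<open>P\<close> of order \<open>2 s + 1\<close> in the centralizer, \<open>f = 0\<close> and the combination begins with a
nonzero multiple of \<open>v\<^sub>s\<^sub>+\<^sub>1\<close>; its derivative is a KdV equation of level \<open>s\<close>. The same formulas, read
backwards, build \<open>P\<close> from a solution (\<open>odd_commuting_order_iff_KdV\<close>).

This needs the \<open>v\<^sub>n\<close> to exist: the right-hand side of the recursion has to be a derivative in the ring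
of differential polynomials. The reason is that \<open>T = - \<partial>\<^sup>3 / 4 + u \<partial> + u' / 2\<close> is skew-adjoint, so
that modulo derivatives \<open>T v\<^sub>n\<close> equals its own negative (\<open>T_in_range\<close>).

For the structure of the centralizer, the leading coefficient of an operator that commutes with \<open>L\<close>
is a constant, so it can be cancelled against any other element of the same order. Let \<open>A\<close>
be an element of the least odd order \<open>2 s + 1\<close>. Cancelling against powers \<open>L\<^sup>k\<close> and products \<open>L\<^sup>k A\<close>
shows that the centralizer is \<open>C[L] + C[L] A\<close>, and that the elements of order below \<open>2 s + 1\<close> lie in
\<open>C[L]\<close>. In particular \<open>A\<^sup>2 = p(L) + q(L) A\<close>; completing the square turns \<open>A\<close> into an operator whose square
lies in \<open>C[L]\<close>, and parity of orders shows that no other monic element of that order has this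
property.\<close>

section \<open>Skew-adjointness of the recursion operator\<close>

locale ring_derivation =
  fixes D :: "'r::comm_ring_1 \<Rightarrow> 'r"
  assumes D_add: "D (a + b) = D a + D b"
    and D_mult: "D (a * b) = D a * b + a * D b"
begin

lemma D_0 [simp]: "D 0 = 0"
  using D_add [of 0 0] by simp

lemma D_uminus: "D (- a) = - D a"
  using D_add [of "- a" a] by (simp add: eq_neg_iff_add_eq_0)

lemma D_diff: "D (a - b) = D a - D b"
  using D_add [of a "- b"] by (simp add: D_uminus)

lemma range_diff: "a \<in> range D \<Longrightarrow> b \<in> range D \<Longrightarrow> a - b \<in> range D"
  by (auto simp flip: D_diff)

end

text \<open>Here \<open>w\<close> is the potential; for the KdV hierarchy, \<open>q = - 1 / 4\<close>. An operator of this shape is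
skew-adjoint for every constant \<open>q\<close>, but the term \<open>w D\<close> forces \<open>h = 1 / 2\<close>.\<close>

locale lenard_operator = ring_derivation D for D :: "'r::comm_ring_1 \<Rightarrow> 'r" +
  fixes T :: "'r \<Rightarrow> 'r" and w q h :: 'r
  assumes T_eq: "T a = q * D (D (D a)) + w * D a + h * D w * a"
    and D_q: "D q = 0" and D_h: "D h = 0" and h_half: "h + h = 1"
begin

text \<open>Integration by parts: \<open>T\<close> is skew-adjoint, with a boundary term that stays inside the ring.\<close>

lemma skew: "a * T b + b * T a \<in> range D"
proof -
  \<comment> \<open>The boundary term, found by integrating each summand of \<open>a T b + b T a\<close> by parts.\<close>
  have "D (q * (a * D (D b) + b * D (D a) - D a * D b) + w * a * b)
     = q * (a * D (D (D b)) + b * D (D (D a))) + w * (a * D b + b * D a) + (h + h) * (D w * a * b)"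
    by (simp add: D_add D_diff D_mult D_q h_half algebra_simps)
  also have "\<dots> = a * T b + b * T a"
    by (simp add: T_eq algebra_simps)
  finally show ?thesis by (metis rangeI)
qed

text \<open>Modulo the range of \<open>D\<close>, skew-adjointness and \<open>D (v\<^sub>i\<^sub>+\<^sub>1) = T v\<^sub>i\<close> together allow one step of the index to
be moved from one factor to the other: \<open>v\<^sub>i T v\<^sub>k\<^sub>+\<^sub>1 \<equiv> - v\<^sub>k\<^sub>+\<^sub>1 D v\<^sub>i\<^sub>+\<^sub>1 \<equiv> v\<^sub>i\<^sub>+\<^sub>1 D v\<^sub>k\<^sub>+\<^sub>1 = v\<^sub>i\<^sub>+\<^sub>1 T v\<^sub>k\<close>.
Moving all of it gives \<open>T v\<^sub>n = v\<^sub>0 T v\<^sub>n \<equiv> v\<^sub>n T v\<^sub>0\<close>, whereas skew-adjointness alone gives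
\<open>v\<^sub>0 T v\<^sub>n \<equiv> - v\<^sub>n T v\<^sub>0\<close>. Hence \<open>2 T v\<^sub>n\<close> is a derivative, and so is its half.\<close>

lemma T_in_range:
  assumes v0: "v 0 = 1" and v_Suc: "\<And>i. i < n \<Longrightarrow> D (v (Suc i)) = T (v i)"
  shows "T (v n) \<in> range D"
proof -
  have "T (v n) - v i * T (v (n - i)) \<in> range D" if "i \<le> n" for i
    using that
  proof (induction i)
    case (Suc i)
    define k where "k = n - Suc i"
    have k: "n - i = Suc k" "k < n" "i < n" using Suc.prems by (auto simp: k_def)
    have "v i * T (v (Suc k)) - v (Suc i) * T (v k)
        = (v i * T (v (Suc k)) + v (Suc k) * T (v i)) - D (v (Suc k) * v (Suc i))"
      using v_Suc [of k] v_Suc [of i] k by (simp add: D_mult algebra_simps)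
    then have "v i * T (v (Suc k)) - v (Suc i) * T (v k) \<in> range D"
      by (metis range_diff skew rangeI)
    moreover have "T (v n) - v i * T (v (Suc k)) \<in> range D"
      using Suc k by simp
    ultimately obtain x y where "v i * T (v (Suc k)) - v (Suc i) * T (v k) = D x"
      "T (v n) - v i * T (v (Suc k)) = D y" by blast
    then have "T (v n) - v (Suc i) * T (v k) = D (y + x)"
      by (simp add: D_add algebra_simps)
    then show ?case by (simp add: k_def)
  qed (simp add: v0 range_eqI [of _ _ 0])
  from this [of n] obtain x where x: "T (v n) - v n * T 1 = D x" by (auto simp: v0)
  obtain y where y: "1 * T (v n) + v n * T 1 = D y" using skew by blast
  \<comment> \<open>The sum of the two congruences is \<open>2 T v\<^sub>n\<close>; multiplying the primitive by \<open>h = 1 / 2\<close> removes the factor.\<close>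
  have "D (h * (x + y)) = h * (D x + D y)"
    by (simp add: D_mult D_add D_h)
  also have "\<dots> = (h + h) * T (v n)"
    by (simp flip: x y add: algebra_simps)
  finally show ?thesis by (metis h_half mult_1 rangeI)
qed

end

section \<open>The derivation on differential polynomials\<close>

lemma diffpoly_additive_induct:
  assumes "\<And>m c. P (Poly_Mapping.single m c)" and "\<And>p q. P p \<Longrightarrow> P q \<Longrightarrow> P (p + q)"
  shows "P (p :: 'c::comm_ring_1 diffpoly)"
proof (induction p rule: update_induct)
  case const
  show ?case using assms(1) [of 0 0] by simp
next
  case (update p m c)
  have "Poly_Mapping.update m c p = p + Poly_Mapping.single m c"
    using update(1) by (intro poly_mapping_eqI)
      (auto simp: lookup_update lookup_add lookup_single when_def in_keys_iff)
  then show ?case using assms update by simp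
qed

lemma dp_der_add: "dp_der (p + q) = dp_der p + dp_der q"
  unfolding dp_der_def
  by (rule setsum_keys_plus_distrib) (simp_all add: distrib_right single_add sum.distrib)

lemma dp_der_single:
  assumes "finite K" "Poly_Mapping.keys m \<subseteq> K"
  shows "dp_der (Poly_Mapping.single m c) = (\<Sum>k\<in>K.
     Poly_Mapping.single (m - Poly_Mapping.single k 1 + Poly_Mapping.single (Suc k) 1)
       (c * of_nat (Poly_Mapping.lookup m k)))"
proof -
  have "dp_der (Poly_Mapping.single m c) = (\<Sum>k\<in>Poly_Mapping.keys m.
     Poly_Mapping.single (m - Poly_Mapping.single k 1 + Poly_Mapping.single (Suc k) 1)
       (c * of_nat (Poly_Mapping.lookup m k)))"
    by (cases "c = 0") (simp_all add: dp_der_def)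
  also have "\<dots> = (\<Sum>k\<in>K.
     Poly_Mapping.single (m - Poly_Mapping.single k 1 + Poly_Mapping.single (Suc k) 1)
       (c * of_nat (Poly_Mapping.lookup m k)))"
    using assms by (intro sum.mono_neutral_left) (auto simp: in_keys_iff)
  finally show ?thesis .
qed

lemma keys_add_nat: "Poly_Mapping.keys (m + n :: nat \<Rightarrow>\<^sub>0 nat) = Poly_Mapping.keys m \<union> Poly_Mapping.keys n"
  by (auto simp: in_keys_iff lookup_add)

text \<open>Truncated subtraction on exponents is harmless as soon as the factor to be removed occurs in \<open>m\<close>.\<close>

lemma shift_factor_add:
  assumes "Poly_Mapping.lookup m k \<noteq> (0::nat)"
  shows "m + n - Poly_Mapping.single k 1 + l = (m - Poly_Mapping.single k 1 + l) + n"
  using assms by (intro poly_mapping_eqI) (auto simp: lookup_add lookup_minus lookup_single when_def)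

text \<open>The terms of the derivative of a product are indexed by the variables of either factor. The
multiplicity of a variable in the product splits as a sum, and a summand whose multiplicity is \<open>0\<close>
does not contribute, which covers the case where the shifted monomial makes no sense.\<close>

lemma dp_der_single_mult:
  fixes a b :: "'c::comm_ring_1"
  shows "dp_der (Poly_Mapping.single m a * Poly_Mapping.single n b)
    = dp_der (Poly_Mapping.single m a) * Poly_Mapping.single n b
      + Poly_Mapping.single m a * dp_der (Poly_Mapping.single n b)"
proof -
  let ?K = "Poly_Mapping.keys m \<union> Poly_Mapping.keys n"
  let ?s = "\<lambda>m k (c::'c). Poly_Mapping.single
      (m - Poly_Mapping.single k 1 + Poly_Mapping.single (Suc k) 1)
      (c * of_nat (Poly_Mapping.lookup m k))"
  have summand: "?s (m + n) k (a * b)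
      = ?s m k a * Poly_Mapping.single n b + Poly_Mapping.single m a * ?s n k b" for k
  proof -
    let ?e = "m + n - Poly_Mapping.single k 1 + Poly_Mapping.single (Suc k) 1"
    have "?s m k a * Poly_Mapping.single n b
        = Poly_Mapping.single ?e (a * b * of_nat (Poly_Mapping.lookup m k))"
      using shift_factor_add [of m k n "Poly_Mapping.single (Suc k) 1"]
      by (cases "Poly_Mapping.lookup m k = 0") (simp_all add: mult_single ac_simps)
    moreover have "Poly_Mapping.single m a * ?s n k b
        = Poly_Mapping.single ?e (a * b * of_nat (Poly_Mapping.lookup n k))"
      using shift_factor_add [of n k m "Poly_Mapping.single (Suc k) 1"]
      by (cases "Poly_Mapping.lookup n k = 0") (simp_all add: mult_single ac_simps)
    ultimately show ?thesis
      by (simp add: lookup_add distrib_left flip: single_add)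
  qed
  have "dp_der (Poly_Mapping.single m a * Poly_Mapping.single n b) = (\<Sum>k\<in>?K. ?s (m + n) k (a * b))"
    by (simp only: mult_single, rule dp_der_single) (simp_all add: keys_add_nat)
  also have "\<dots> = (\<Sum>k\<in>?K. ?s m k a) * Poly_Mapping.single n b
      + Poly_Mapping.single m a * (\<Sum>k\<in>?K. ?s n k b)"
    by (simp only: summand sum.distrib sum_distrib_left sum_distrib_right)
  also have "(\<Sum>k\<in>?K. ?s m k a) = dp_der (Poly_Mapping.single m a)"
    by (rule dp_der_single [symmetric]) simp_all
  also have "(\<Sum>k\<in>?K. ?s n k b) = dp_der (Poly_Mapping.single n b)"
    by (rule dp_der_single [symmetric]) simp_all
  finally show ?thesis .
qed

lemma dp_der_mult: "dp_der (p * q) = dp_der p * q + p * dp_der q"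
proof (induction p rule: diffpoly_additive_induct)
  case (1 m c)
  show ?case
    by (induction q rule: diffpoly_additive_induct)
      (simp_all add: dp_der_single_mult distrib_left dp_der_add algebra_simps)
qed (simp add: distrib_right dp_der_add algebra_simps)

lemma dp_der_const [simp]: "dp_der (dp_const c) = 0"
  unfolding dp_const_def by (subst dp_der_single [of "{}"]) simp_all

lemma dp_der_var: "dp_der (dp_var k) = dp_var (Suc k)"
  unfolding dp_var_def by (subst dp_der_single [of "{k}"]) simp_all

text \<open>Take the variable of highest index \<open>N\<close> that occurs, and a monomial \<open>m\<close> that contains it. Replacing one
factor of index \<open>N\<close> in \<open>m\<close> by one of index \<open>N + 1\<close> gives a monomial that arises in the derivative
in no other way, and its coefficient is nonzero in characteristic zero.\<close>

lemma dp_der_eq_0_imp_const: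
  fixes p :: "'c::{idom, ring_char_0} diffpoly"
  assumes "dp_der p = 0"
  shows "p = dp_const (Poly_Mapping.lookup p 0)"
proof -
  have "Poly_Mapping.keys p \<subseteq> {0}"
  proof (rule ccontr)
    assume "\<not> Poly_Mapping.keys p \<subseteq> {0}"
    then obtain m0 where "m0 \<in> Poly_Mapping.keys p" "Poly_Mapping.keys m0 \<noteq> {}" by auto
    then have ne: "(\<Union>m\<in>Poly_Mapping.keys p. Poly_Mapping.keys m) \<noteq> {}" by blast
    define N where "N = Max (\<Union>m\<in>Poly_Mapping.keys p. Poly_Mapping.keys m)"
    have "N \<in> (\<Union>m\<in>Poly_Mapping.keys p. Poly_Mapping.keys m)"
      unfolding N_def using ne by (intro Max_in) auto
    then obtain m where m: "m \<in> Poly_Mapping.keys p" "Poly_Mapping.lookup m N \<noteq> 0"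
      by (auto simp: in_keys_iff)
    have top: "k \<le> N" if "m' \<in> Poly_Mapping.keys p" "k \<in> Poly_Mapping.keys m'" for m' k
      unfolding N_def using that by (intro Max_ge) auto
    let ?sh = "\<lambda>m k. m - Poly_Mapping.single k 1 + Poly_Mapping.single (Suc k) (1::nat)"
    have only: "k = N \<and> m' = m"
      if m': "m' \<in> Poly_Mapping.keys p" "k \<in> Poly_Mapping.keys m'" and eq: "?sh m' k = ?sh m N" for m' k
    proof -
      have z: "Poly_Mapping.lookup m'' (Suc N) = 0" if "m'' \<in> Poly_Mapping.keys p" for m''
        using top [OF that, of "Suc N"] by (auto simp: in_keys_iff)
      have "Poly_Mapping.lookup (?sh m' k) (Suc N) = Poly_Mapping.lookup (?sh m N) (Suc N)"
        by (simp only: eq)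
      then have "k = N"
        using z m m' by (auto simp: lookup_add lookup_minus lookup_single when_def split: if_splits)
      moreover have "Poly_Mapping.lookup m' i = Poly_Mapping.lookup m i" for i
      proof -
        have "Poly_Mapping.lookup (?sh m' k) i = Poly_Mapping.lookup (?sh m N) i"
          by (simp only: eq)
        then show ?thesis
          using m m' \<open>k = N\<close>
          by (auto simp: lookup_add lookup_minus lookup_single when_def in_keys_iff split: if_splits)
      qed
      ultimately show ?thesis by (simp add: poly_mapping_eqI)
    qed
    have "Poly_Mapping.lookup (dp_der p) (?sh m N)
      = (\<Sum>m'\<in>Poly_Mapping.keys p. \<Sum>k\<in>Poly_Mapping.keys m'.
          if m' = m \<and> k = N then Poly_Mapping.lookup p m * of_nat (Poly_Mapping.lookup m N) else 0)"
      unfolding dp_der_def lookup_sum lookup_single when_def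
      by (intro sum.cong refl) (use only in auto)
    also have "\<dots> = (\<Sum>m'\<in>Poly_Mapping.keys p. if m' = m then
          (\<Sum>k\<in>Poly_Mapping.keys m. if k = N then Poly_Mapping.lookup p m * of_nat (Poly_Mapping.lookup m N) else 0) else 0)"
      by (intro sum.cong refl) auto
    also have "\<dots> = Poly_Mapping.lookup p m * of_nat (Poly_Mapping.lookup m N)"
      using m by (simp add: in_keys_iff)
    finally show False using m assms by (simp add: in_keys_iff)
  qed
  then show ?thesis
    by (intro poly_mapping_eqI) (auto simp: dp_const_def lookup_single when_def in_keys_iff)
qed

text \<open>The antiderivative without constant term exists because the constant term of any antiderivative can be
subtracted, and it is unique because two antiderivatives differ by a constant.\<close>

lemma dp_der_antider:
  fixes p :: "'c::{idom, ring_char_0} diffpoly"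
  assumes "p \<in> range dp_der"
  shows "dp_der (dp_antider p) = p"
proof -
  from assms obtain q where q: "p = dp_der q" by blast
  define r where "r = q + dp_const (- Poly_Mapping.lookup q 0)"
  have "dp_der r = p \<and> Poly_Mapping.lookup r 0 = 0"
    unfolding r_def by (simp add: dp_der_add q lookup_add) (simp add: dp_const_def)
  moreover have "r' = r" if "dp_der r' = p \<and> Poly_Mapping.lookup r' 0 = 0" for r'
  proof -
    have "dp_der r' = dp_der (r' - r) + dp_der r" by (simp flip: dp_der_add)
    then have "r' - r = dp_const (Poly_Mapping.lookup (r' - r) 0)"
      using that calculation by (intro dp_der_eq_0_imp_const) simp
    then show ?thesis
      using that calculation by (simp add: lookup_minus dp_const_def)
  qed
  ultimately show ?thesis
    unfolding dp_antider_def by (rule theI2) blast+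
qed

lemma dp_const_add: "dp_const (a + b) = dp_const a + dp_const b"
  by (simp add: dp_const_def single_add)

lemma dp_const_1 [simp]: "dp_const 1 = 1"
  by (simp add: dp_const_def)

section \<open>The KdV hierarchy and its primitives\<close>

text \<open>These are the \<open>v\<^sub>n\<close> of the hierarchy, defined through \<open>2 \<partial>(v\<^sub>n\<^sub>+\<^sub>1) = kdv\<^sub>n\<close>.\<close>

definition kdv_primitive :: "nat \<Rightarrow> 'c::field diffpoly" where
  "kdv_primitive n = (if n = 0 then 1 else dp_const (1 / 2) * dp_antider (kdv (n - 1)))"

lemma two_dp_const_half: "2 * (dp_const (1 / 2) * p) = (p :: 'c::field_char_0 diffpoly)"
proof -
  have "2 * (dp_const (1 / 2) * p) = dp_const (1 / 2 + 1 / 2 :: 'c) * p"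
    by (simp only: dp_const_add mult_2 distrib_right)
  then show ?thesis by simp
qed

definition lenard :: "'c::field diffpoly \<Rightarrow> 'c diffpoly" where
  "lenard p = dp_const (- 1 / 4) * dp_der (dp_der (dp_der p)) + dp_var 0 * dp_der p
     + dp_const (1 / 2) * dp_var 1 * p"

interpretation lenard: lenard_operator dp_der lenard "dp_var 0" "dp_const (- 1 / 4)"
    "dp_const (1 / 2) :: 'c::field_char_0 diffpoly"
  by standard (simp_all add: lenard_def dp_der_add dp_der_mult dp_der_var flip: dp_const_add)

text \<open>Since \<open>v\<^sub>n\<close> is half of the antiderivative of \<open>kdv\<^sub>n\<^sub>-\<^sub>1\<close>, the recursion operator
\<open>- \<partial>\<^sup>2 / 4 + u + u' \<partial>\<^sup>-\<^sup>1 / 2\<close> applied to \<open>kdv\<^sub>n\<^sub>-\<^sub>1\<close> is twice the Lenard operator applied to \<open>v\<^sub>n\<close>.\<close>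

lemma kdv_eq_lenard:
  fixes n :: nat
  assumes "n > 0 \<Longrightarrow> dp_der (dp_antider (kdv (n - 1))) = (kdv (n - 1) :: 'c::field_char_0 diffpoly)"
  shows "kdv n = 2 * lenard (kdv_primitive n :: 'c diffpoly)"
proof (cases n)
  case 0
  have "lenard (1 :: 'c diffpoly) = dp_const (1 / 2) * dp_var 1"
    using dp_der_const [of "1 :: 'c"] by (simp add: lenard_def)
  then show ?thesis
    using two_dp_const_half [of "dp_var 1 :: 'c diffpoly"] by (simp add: kdv_primitive_def 0)
next
  case (Suc m)
  have "2 * lenard (kdv_primitive n) = lenard (2 * kdv_primitive n :: 'c diffpoly)"
    by (simp only: lenard_def mult_2 dp_der_add distrib_left)
  also have "2 * kdv_primitive n = (dp_antider (kdv m) :: 'c diffpoly)"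
    by (simp add: kdv_primitive_def Suc two_dp_const_half)
  also have "lenard \<dots> = kdv n"
    using assms by (simp add: lenard_def Suc)
  finally show ?thesis ..
qed

text \<open>Both claims go through one induction: that the earlier \<open>v\<^sub>i\<close> obey the Lenard recursion makes \<open>kdv\<^sub>n\<close>
a derivative, and then \<open>v\<^sub>n\<^sub>+\<^sub>1\<close> obeys the recursion as well.\<close>

lemma kdv_primitive_aux:
  "dp_der (dp_antider (kdv n)) = (kdv n :: 'c::field_char_0 diffpoly)"
  "dp_der (kdv_primitive (Suc n)) = lenard (kdv_primitive n :: 'c diffpoly)"
proof (induction n rule: less_induct)
  case (less n)
  have "lenard (kdv_primitive n :: 'c diffpoly) \<in> range dp_der"
    using less.IH by (intro lenard.T_in_range) (simp_all add: kdv_primitive_def)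
  then obtain x where x: "lenard (kdv_primitive n :: 'c diffpoly) = dp_der x" by blast
  have kdv: "kdv n = 2 * lenard (kdv_primitive n :: 'c diffpoly)"
    using less.IH(1) [of "n - 1"] by (intro kdv_eq_lenard) simp
  have "kdv n = dp_der (2 * x)"
    by (simp only: mult_2 dp_der_add kdv x)
  then show d: "dp_der (dp_antider (kdv n)) = (kdv n :: 'c diffpoly)"
    by (intro dp_der_antider) simp
  have "dp_der (kdv_primitive (Suc n) :: 'c diffpoly) = dp_const (1 / 2) * kdv n"
    by (simp add: kdv_primitive_def dp_der_mult d)
  also have "\<dots> = lenard (kdv_primitive n)"
    using two_dp_const_half [of "lenard (kdv_primitive n) :: 'c diffpoly"]
    by (simp add: kdv mult_ac)
  finally show "dp_der (kdv_primitive (Suc n)) = lenard (kdv_primitive n :: 'c diffpoly)" .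
qed

lemma dp_der_kdv_primitive: "dp_der (kdv_primitive (Suc n)) = lenard (kdv_primitive n :: 'c::field_char_0 diffpoly)"
  by (rule kdv_primitive_aux)

lemma kdv_eq: "kdv n = 2 * dp_der (kdv_primitive (Suc n) :: 'c::field_char_0 diffpoly)"
  unfolding dp_der_kdv_primitive by (intro kdv_eq_lenard kdv_primitive_aux)

section \<open>Evaluation of differential polynomials\<close>

lemma of_const_simps [simp]:
  "of_const 0 = 0" "of_const 1 = 1" "of_const (a + b) = of_const a + of_const b"
  "of_const (a * b) = of_const a * of_const b" "of_const (- a) = - of_const a"
  "of_const (a / b) = of_const a / of_const b" "der (of_const a) = 0"
  using of_const [of a]
  by (simp_all add: zero_const.rep_eq one_const.rep_eq plus_const.rep_eq times_const.rep_eq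
      uminus_const.rep_eq divide_const.rep_eq constants_def)

lemma of_const_numeral [simp]: "of_const (numeral n) = numeral n"
  by (metis of_const_of_nat of_nat_numeral)

lemma der_half: "der (a / 2) = der a / (2 :: 'a::{differential_field, field_char_0})"
proof -
  have "der (a / 2) + der (a / 2) = der (a / 2 + a / 2)" by (rule der_add [symmetric])
  also have "a / 2 + a / 2 = a" by simp
  finally have "der a = der (a / 2) + der (a / 2)" ..
  then show ?thesis by (simp add: field_simps)
qed

lemma constant_of_const: "der c = 0 \<Longrightarrow> \<exists>c'. of_const c' = c"
  by (metis Abs_const_inverse constants_def mem_Collect_eq)

lemma dp_eval_0 [simp]: "dp_eval u 0 = 0"
  by (simp add: dp_eval_def)

lemma dp_eval_add: "dp_eval w (p + q) = dp_eval w p + dp_eval w q"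
  unfolding dp_eval_def
  by (rule setsum_keys_plus_distrib) (simp_all add: distrib_right)

lemma dp_eval_single:
  assumes "finite K" "Poly_Mapping.keys m \<subseteq> K"
  shows "dp_eval w (Poly_Mapping.single m c) =
    of_const c * (\<Prod>k\<in>K. ((der ^^ k) w) ^ Poly_Mapping.lookup m k)"
proof -
  have "dp_eval w (Poly_Mapping.single m c) =
      of_const c * (\<Prod>k\<in>Poly_Mapping.keys m. ((der ^^ k) w) ^ Poly_Mapping.lookup m k)"
    by (cases "c = 0") (simp_all add: dp_eval_def)
  also have "(\<Prod>k\<in>Poly_Mapping.keys m. ((der ^^ k) w) ^ Poly_Mapping.lookup m k) =
      (\<Prod>k\<in>K. ((der ^^ k) w) ^ Poly_Mapping.lookup m k)"
    using assms by (intro prod.mono_neutral_left) (auto simp: in_keys_iff)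
  finally show ?thesis .
qed

lemma dp_eval_mult: "dp_eval w (p * q) = dp_eval w p * dp_eval w q"
proof (induction p rule: diffpoly_additive_induct)
  case (1 m c)
  show ?case
  proof (induction q rule: diffpoly_additive_induct)
    case (1 n d)
    let ?K = "Poly_Mapping.keys m \<union> Poly_Mapping.keys n"
    show ?case
      by (simp add: mult_single dp_eval_single [of ?K] keys_add_nat lookup_add power_add
          prod.distrib mult_ac)
  qed (simp add: distrib_left dp_eval_add)
qed (simp add: distrib_right dp_eval_add)

lemma dp_eval_const [simp]: "dp_eval w (dp_const c) = of_const c"
  unfolding dp_const_def by (subst dp_eval_single [of "{}"]) simp_all

lemma dp_eval_var [simp]: "dp_eval w (dp_var k) = (der ^^ k) w"
  unfolding dp_var_def by (subst dp_eval_single [of "{k}"]) simp_all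

lemma diffpoly_induct [case_names const var add mult]:
  assumes const: "\<And>c. P (dp_const c)" and var: "\<And>k. P (dp_var k)"
    and add: "\<And>p q. P p \<Longrightarrow> P q \<Longrightarrow> P (p + q)" and mult: "\<And>p q. P p \<Longrightarrow> P q \<Longrightarrow> P (p * q)"
  shows "P (p :: 'c::comm_ring_1 diffpoly)"
proof (induction p rule: diffpoly_additive_induct)
  case (1 m c)
  have "P (Poly_Mapping.single m 1)" for m :: "nat \<Rightarrow>\<^sub>0 nat"
  proof (induction m rule: update_induct)
    case const
    show ?case using assms(1) [of 1] by (simp add: dp_const_def)
  next
    case (update m k e)
    have pow: "P (Poly_Mapping.single (Poly_Mapping.single k e) 1)" for e
    proof (induction e)
      case 0
      show ?case using assms(1) [of 1] by (simp add: dp_const_def)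
    next
      case (Suc e)
      then have "P (dp_var k * Poly_Mapping.single (Poly_Mapping.single k e) 1)"
        by (intro mult var)
      then show ?case by (simp add: dp_var_def mult_single flip: single_add)
    qed
    have "Poly_Mapping.update k e m = m + Poly_Mapping.single k e"
      using update(1) by (intro poly_mapping_eqI)
        (auto simp: lookup_update lookup_add lookup_single when_def in_keys_iff)
    then show ?case using mult [OF update(3) pow [of e]] by (simp add: mult_single)
  qed
  then have "P (dp_const c * Poly_Mapping.single m 1)" by (intro mult const)
  then show ?case by (simp add: dp_const_def mult_single)
qed (rule add)

text \<open>Both sides are derivations along the evaluation homomorphism, so it is enough to compare them on
constants and variables.\<close>

lemma dp_eval_der: "dp_eval w (dp_der p) = der (dp_eval w p)"
  by (induction p rule: diffpoly_induct)
    (simp_all add: dp_der_var dp_der_add dp_der_mult dp_eval_add dp_eval_mult der_add der_mult)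

definition kdv_value :: "'a::{differential_field, field_char_0} \<Rightarrow> nat \<Rightarrow> 'a" where
  "kdv_value u n = dp_eval u (kdv_primitive n)"

lemma kdv_value_0 [simp]: "kdv_value u 0 = 1"
  using dp_eval_const [of u 1] by (simp add: kdv_value_def kdv_primitive_def)

lemma dp_eval_2: "dp_eval u 2 = 2"
  using dp_eval_const [of u 2] by (simp add: dp_const_def)

lemma der_kdv_value:
  "der (kdv_value u (Suc n)) = - der (der (der (kdv_value u n))) / 4
     + u * der (kdv_value u n) + der u * kdv_value u n / 2"
  unfolding kdv_value_def dp_eval_der [symmetric] dp_der_kdv_primitive
  by (simp add: lenard_def dp_eval_add dp_eval_mult)

lemma dp_eval_kdv: "dp_eval u (kdv n) = 2 * der (kdv_value u (Suc n))"
  by (simp add: kdv_eq dp_eval_mult dp_eval_2 dp_eval_der kdv_value_def)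

text \<open>The general solution of the integrated recursion: each step of the Lenard recursion determines the next
function up to a constant, and \<open>c i\<close> is the constant chosen at step \<open>i\<close>.\<close>

definition kdv_combination ::
    "'a::{differential_field, field_char_0} \<Rightarrow> (nat \<Rightarrow> 'a const) \<Rightarrow> nat \<Rightarrow> 'a" where
  "kdv_combination u c n = (\<Sum>i\<le>n. of_const (c i) * kdv_value u (n - i))"

lemma der_sum: "der (sum f A) = (\<Sum>i\<in>A. der (f i))"
  by (induction A rule: infinite_finite_induct) (simp_all add: der_add)

lemma dp_eval_sum: "dp_eval u (sum f A) = (\<Sum>i\<in>A. dp_eval u (f i))"
  by (induction A rule: infinite_finite_induct) (simp_all add: dp_eval_add)

lemma kdv_combination_0: "kdv_combination u c 0 = of_const (c 0)"
  by (simp add: kdv_combination_def)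

text \<open>The last summand of the combination, \<open>c\<^sub>s\<^sub>+\<^sub>1 v\<^sub>0\<close>, is a constant and disappears under the derivative;
the others give the terms of the KdV equation.\<close>

lemma dp_eval_KdV:
  assumes "c 0 = 1"
  shows "dp_eval u (KdV s c) = 2 * der (kdv_combination u c (Suc s))"
proof -
  have "der (kdv_combination u c (Suc s)) = (\<Sum>i\<le>s. of_const (c i) * der (kdv_value u (Suc s - i)))"
    by (simp add: kdv_combination_def der_sum der_add der_mult)
  also have "\<dots> = der (kdv_value u (Suc s)) + (\<Sum>i=1..s. of_const (c i) * der (kdv_value u (Suc s - i)))"
    by (simp add: assms atMost_atLeast0 sum.atLeast_Suc_atMost)
  finally show ?thesis
    by (simp add: KdV_def dp_eval_add dp_eval_sum dp_eval_mult dp_eval_kdv Suc_diff_le sum_distrib_left algebra_simps)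
qed

lemma der_kdv_combination:
  "der (kdv_combination u c (Suc n)) = - der (der (der (kdv_combination u c n))) / 4
     + u * der (kdv_combination u c n) + der u * kdv_combination u c n / 2"
proof -
  have "der (kdv_combination u c (Suc n)) = (\<Sum>i\<le>n. of_const (c i) * der (kdv_value u (Suc (n - i))))"
    by (simp add: kdv_combination_def der_sum der_add der_mult Suc_diff_le)
  also have "\<dots> = (\<Sum>i\<le>n. - (of_const (c i) * der (der (der (kdv_value u (n - i)))) / 4)
      + u * (of_const (c i) * der (kdv_value u (n - i)))
      + der u * (of_const (c i) * kdv_value u (n - i)) / 2)"
    by (simp add: der_kdv_value algebra_simps)
  also have "\<dots> = - der (der (der (kdv_combination u c n))) / 4
     + u * der (kdv_combination u c n) + der u * kdv_combination u c n / 2"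
    by (simp add: kdv_combination_def der_sum der_mult sum.distrib sum_negf sum_subtractf
        sum_distrib_left sum_divide_distrib)
  finally show ?thesis .
qed

section \<open>Orders and leading coefficients of operators\<close>

lemma diffop_eqI: "(\<And>n. op_coeff P n = op_coeff Q n) \<Longrightarrow> P = Q"
  unfolding op_coeff_def by (metis op_poly_inject poly_eqI)

lemma op_coeff_simps [simp]:
  "op_coeff 0 n = 0"
  "op_coeff 1 n = (if n = 0 then 1 else 0)"
  "op_coeff (op_scalar a) n = (if n = 0 then a else 0)"
  "op_coeff (P + Q) n = op_coeff P n + op_coeff Q n"
  "op_coeff (P - Q) n = op_coeff P n - op_coeff Q n"
  "op_coeff (- P) n = - op_coeff P n"
  "op_coeff (op_scalar a * P) n = a * op_coeff P n"
  by (simp_all add: op_coeff_def zero_diffop.rep_eq one_diffop.rep_eq op_scalar.rep_eq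
      plus_diffop.rep_eq minus_diffop.rep_eq uminus_diffop.rep_eq times_diffop.rep_eq
      op_times_pCons coeff_pCons split: nat.split)

lemma op_coeff_del_mult:
  "op_coeff (\<partial> * P) n = der (op_coeff P n) + (case n of 0 \<Rightarrow> 0 | Suc m \<Rightarrow> op_coeff P m)"
  by (simp add: op_coeff_def times_diffop.rep_eq op_del.rep_eq op_times_pCons del_left_def
      coeff_pCons split: nat.split)

lemma op_coeff_del: "op_coeff \<partial> n = (if n = 1 then 1 else 0)"
  by (simp add: op_coeff_def op_del.rep_eq coeff_pCons split: nat.split)

lemma op_coeff_mult_del: "op_coeff (P * \<partial>) n = (case n of 0 \<Rightarrow> 0 | Suc m \<Rightarrow> op_coeff P m)"
proof -
  have monom: "op_times p (monom 1 k) = monom 1 k * p" for p :: "'a poly" and k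
  proof (induction p arbitrary: k)
    case (pCons a p)
    have "del_left (monom 1 k :: 'a poly) = monom 1 (Suc k)"
      by (simp add: del_left_def poly_eq_iff coeff_pCons split: nat.split)
    then have "op_times (pCons a p) (monom 1 k) = smult a (monom 1 k) + monom 1 (Suc k) * p"
      by (simp only: op_times_pCons pCons.IH)
    also have "\<dots> = monom 1 k * pCons a p"
      by (simp add: monom_Suc)
    finally show ?case .
  qed simp
  have "[:0, 1:] = monom (1 :: 'a) 1"
    by (simp add: poly_eq_iff coeff_pCons split: nat.split)
  then show ?thesis
    by (simp add: op_coeff_def times_diffop.rep_eq op_del.rep_eq monom coeff_monom_mult
        split: nat.split)
qed

lemma op_coeff_del_power: "op_coeff (\<partial> ^ k :: 'a::differential_field diffop) n = (if n = k then 1 else 0)"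
proof (induction k arbitrary: n)
  case (Suc k)
  have "op_coeff (\<partial> ^ Suc k :: 'a diffop) n = op_coeff (\<partial> * \<partial> ^ k) n" by (simp only: power_Suc)
  also have "\<dots> = (if n = Suc k then 1 else 0)"
    unfolding op_coeff_del_mult Suc.IH by (cases n) simp_all
  finally show ?case .
qed simp

lemma op_scalar_add: "op_scalar (a + b) = op_scalar a + op_scalar b"
  by (rule diffop_eqI) simp

lemma op_scalar_mult: "op_scalar a * op_scalar b = op_scalar (a * b)"
  by (rule diffop_eqI) simp

lemma op_scalar_uminus: "op_scalar (- a) = - op_scalar a"
  by (rule diffop_eqI) simp

lemma op_scalar_0 [simp]: "op_scalar 0 = 0"
  by (rule diffop_eqI) simp

lemma op_scalar_1 [simp]: "op_scalar 1 = 1"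
  by (rule diffop_eqI) simp

lemma op_order_0 [simp]: "op_order 0 = 0"
  by (simp add: op_order_def zero_diffop.rep_eq)

lemma op_order_uminus [simp]: "op_order (- P) = op_order P"
  by (simp add: op_order_def uminus_diffop.rep_eq)

text \<open>A strict bound on the order that only the zero operator meets for \<open>n = 0\<close>; \<open>op_order\<close> cannot express
this, as it does not distinguish the zero operator from nonzero scalars.\<close>

definition order_below :: "'a::differential_field diffop \<Rightarrow> nat \<Rightarrow> bool" where
  "order_below P n \<longleftrightarrow> (\<forall>i\<ge>n. op_coeff P i = 0)"

lemma order_below_0: "order_below P 0 \<longleftrightarrow> P = 0"
  by (auto simp: order_below_def intro: diffop_eqI)

lemma order_below_mono: "order_below P m \<Longrightarrow> m \<le> n \<Longrightarrow> order_below P n"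
  by (simp add: order_below_def)

lemma order_below_Suc_op_order: "order_below P (Suc (op_order P))"
  by (simp add: order_below_def op_coeff_def op_order_def coeff_eq_0)

lemma op_coeff_op_order_nonzero: "P \<noteq> 0 \<Longrightarrow> op_coeff P (op_order P) \<noteq> 0"
  by (metis leading_coeff_neq_0 op_coeff_def op_order_def op_poly_inject zero_diffop.rep_eq)

lemma op_order_eqI: "order_below P (Suc n) \<Longrightarrow> op_coeff P n \<noteq> 0 \<Longrightarrow> op_order P = n"
  by (metis Suc_leI linorder_neqE_nat op_coeff_op_order_nonzero op_coeff_simps(1) order_below_def
      order_below_Suc_op_order)

lemma op_order_less: "order_below P n \<Longrightarrow> P \<noteq> 0 \<Longrightarrow> op_order P < n"
  by (metis linorder_not_less op_coeff_op_order_nonzero order_below_def)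

lemma order_below_diff: "order_below P n \<Longrightarrow> order_below Q n \<Longrightarrow> order_below (P - Q) n"
  by (simp add: order_below_def)

text \<open>Moving \<open>\<partial>\<close> past a coefficient only creates terms of lower order, so operators multiply like
polynomials at the top.\<close>

lemma top_coeff_mult:
  assumes "order_below P (Suc m)" "order_below Q (Suc n)"
  shows "order_below (P * Q) (Suc (m + n))"
    and "op_coeff (P * Q) (m + n) = op_coeff P m * op_coeff Q n"
proof -
  have "coeff (op_times p q) (m + n) = coeff p m * coeff q n \<and>
      (\<forall>i>m + n. coeff (op_times p q) i = 0)"
    if "\<forall>i>m. coeff p i = 0" "\<forall>i>n. coeff q i = 0" for p q :: "'a poly"
    using that
  proof (induction p arbitrary: m n q)
    case (pCons a p)
    show ?case
    proof (cases m)
      case 0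
      have "p = 0"
        using pCons.prems(1) 0 by (intro poly_eqI) (metis coeff_pCons_Suc coeff_0 zero_less_Suc)
      then show ?thesis using pCons.prems(2) 0 by (simp add: op_times_pCons)
    next
      case (Suc m')
      have p: "\<forall>i>m'. coeff p i = 0"
        using pCons.prems(1) Suc by (metis Suc_less_eq coeff_pCons_Suc)
      have q: "\<forall>i>Suc n. coeff (del_left q) i = 0"
        using pCons.prems(2) by (auto simp: del_left_def coeff_pCons split: nat.split)
      have "coeff (del_left q) (Suc n) = coeff q n"
        using pCons.prems(2) by (simp add: del_left_def)
      then show ?thesis
        using pCons.IH [OF p q] pCons.prems(2) Suc by (simp add: op_times_pCons)
    qed
  qed simp
  from this [of "op_poly P" "op_poly Q"] assms
  show "order_below (P * Q) (Suc (m + n))"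
    and "op_coeff (P * Q) (m + n) = op_coeff P m * op_coeff Q n"
    by (simp_all add: order_below_def op_coeff_def times_diffop.rep_eq Suc_le_eq)
qed

lemma op_order_mult:
  assumes "P \<noteq> 0" "Q \<noteq> 0"
  shows "op_order (P * Q) = op_order P + op_order Q" and "P * Q \<noteq> 0"
proof -
  have c: "op_coeff (P * Q) (op_order P + op_order Q) \<noteq> 0"
    using assms by (simp add: top_coeff_mult(2) order_below_Suc_op_order op_coeff_op_order_nonzero)
  then show "op_order (P * Q) = op_order P + op_order Q"
    by (intro op_order_eqI top_coeff_mult order_below_Suc_op_order)
  show "P * Q \<noteq> 0" using c by auto
qed

lemma op_order_add_less: "op_order P < op_order Q \<Longrightarrow> op_order (P + Q) = op_order Q"
  unfolding op_order_def plus_diffop.rep_eq by (rule degree_add_eq_right)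

section \<open>Schroedinger operators: commutators and right division\<close>

lemma op_coeff_schroedinger:
  "op_coeff (schroedinger u) n = (if n = 0 then u else if n = 2 then - 1 else 0)"
  by (simp add: schroedinger_def op_coeff_del_power)

lemma order_below_schroedinger: "order_below (schroedinger u) (Suc 2)"
  by (simp add: order_below_def op_coeff_schroedinger)

lemma schroedinger_nonzero [simp]: "schroedinger u \<noteq> 0"
  using op_coeff_schroedinger [of u 2] by auto

lemma op_order_schroedinger: "op_order (schroedinger u) = 2"
  by (intro op_order_eqI order_below_schroedinger) (simp add: op_coeff_schroedinger)

lemma schroedinger_mult: "schroedinger u * P = op_scalar u * P - \<partial> * (\<partial> * P)"
  by (simp add: schroedinger_def power2_eq_square algebra_simps)

lemma commutator_schroedinger_first_order:
  "schroedinger u * (op_scalar a * \<partial> + op_scalar b) - (op_scalar a * \<partial> + op_scalar b) * schroedinger u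
    = op_scalar (2 * der a) * schroedinger u
      - op_scalar (der (der a) + 2 * der b) * \<partial>
      - op_scalar (der (der b) + a * der u + 2 * der a * u)"
proof (rule diffop_eqI)
  fix n :: nat
  have [simp]: "(op_scalar a * \<partial> + op_scalar b) * schroedinger u
    = op_scalar a * (\<partial> * schroedinger u) + op_scalar b * schroedinger u"
    by (simp add: algebra_simps)
  consider "n = 0" | "n = 1" | "n = 2" | "n = 3" | "n > 3" by linarith
  then show "op_coeff (schroedinger u * (op_scalar a * \<partial> + op_scalar b) - (op_scalar a * \<partial> + op_scalar b) * schroedinger u) n
    = op_coeff (op_scalar (2 * der a) * schroedinger u
      - op_scalar (der (der a) + 2 * der b) * \<partial>
      - op_scalar (der (der b) + a * der u + 2 * der a * u)) n"
    by cases (simp_all add: schroedinger_mult op_coeff_del_mult op_coeff_del op_coeff_schroedinger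
      der_add der_uminus algebra_simps numeral_2_eq_2 numeral_3_eq_3 split: nat.splits)
qed

text \<open>The term \<open>- 2 a' \<partial>\<^sup>2\<close> of \<open>[L, a \<partial> + b]\<close> is \<open>2 a' L - 2 a' u\<close>; it therefore adds to the quotient \<open>[L, P]\<close>,
and what is left is a remainder of order at most one. Thus the commutator of a divided operator is
itself given in divided form.\<close>

lemma commutator_schroedinger_step:
  fixes u a b :: "'a::differential_field"
  defines "L \<equiv> schroedinger u"
  shows "L * (P * L + (op_scalar a * \<partial> + op_scalar b)) - (P * L + (op_scalar a * \<partial> + op_scalar b)) * L
    = (L * P - P * L + op_scalar (2 * der a)) * L
      + (op_scalar (- (der (der a) + 2 * der b)) * \<partial>
      + op_scalar (- (der (der b) + a * der u + 2 * der a * u)))"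
proof -
  have "L * (P * L + (op_scalar a * \<partial> + op_scalar b)) - (P * L + (op_scalar a * \<partial> + op_scalar b)) * L
    = (L * P - P * L) * L + (L * (op_scalar a * \<partial> + op_scalar b) - (op_scalar a * \<partial> + op_scalar b) * L)"
    by (simp add: algebra_simps)
  also have "\<dots> = (L * P - P * L + op_scalar (2 * der a)) * L
      + (op_scalar (- (der (der a) + 2 * der b)) * \<partial>
      + op_scalar (- (der (der b) + a * der u + 2 * der a * u)))"
    unfolding L_def commutator_schroedinger_first_order op_scalar_uminus by (simp add: algebra_simps)
  finally show ?thesis .
qed

lemma right_division_schroedinger:
  assumes "order_below P (n + 2)"
  shows "\<exists>Q a b. P = Q * schroedinger u + (op_scalar a * \<partial> + op_scalar b) \<and> order_below Q n"
  using assms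
proof (induction n arbitrary: P)
  case 0
  have "P = 0 * schroedinger u + (op_scalar (op_coeff P 1) * \<partial> + op_scalar (op_coeff P 0))"
    using 0 by (intro diffop_eqI) (auto simp: op_coeff_del order_below_def not_less_eq_eq)
  then show ?case by (metis order_below_0)
next
  case (Suc n)
  \<comment> \<open>\<open>L\<close> has leading coefficient \<open>- 1\<close>, so adding \<open>B L\<close> removes the top term of \<open>P\<close>.\<close>
  define B where "B = op_scalar (op_coeff P (n + 2)) * \<partial> ^ n"
  have B: "order_below B (Suc n)" "op_coeff B n = op_coeff P (n + 2)"
    by (simp_all add: B_def order_below_def op_coeff_del_power)
  note BL = top_coeff_mult [OF B(1) order_below_schroedinger [of u]]
  have "order_below (P + B * schroedinger u) (n + 2)"
    unfolding order_below_def
  proof (intro allI impI)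
    fix i assume "n + 2 \<le> i"
    then consider "i = n + 2" | "Suc (n + 2) \<le> i" by linarith
    then show "op_coeff (P + B * schroedinger u) i = 0"
      using BL B Suc.prems by cases (auto simp: order_below_def op_coeff_schroedinger)
  qed
  then obtain Q a b where Q: "P + B * schroedinger u
      = Q * schroedinger u + (op_scalar a * \<partial> + op_scalar b)" "order_below Q n"
    using Suc.IH by blast
  have "P = (P + B * schroedinger u) - B * schroedinger u" by simp
  also have "\<dots> = (Q - B) * schroedinger u + (op_scalar a * \<partial> + op_scalar b)"
    unfolding Q(1) by (simp add: algebra_simps)
  finally have "P = (Q - B) * schroedinger u + (op_scalar a * \<partial> + op_scalar b)" .
  moreover have "order_below (Q - B) (Suc n)"
    by (intro order_below_diff B(1) order_below_mono [OF Q(2)]) simp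
  ultimately show ?case by blast
qed

text \<open>A nonzero quotient would contribute a term of order at least two. The right-hand side is a
scalar, which is the only kind of dividend that the commutator argument compares with.\<close>

lemma right_division_schroedinger_unique:
  assumes "P * schroedinger u + (op_scalar a * \<partial> + op_scalar b) = op_scalar e"
  shows "P = 0" and "a = 0" and "b = e"
proof -
  show P: "P = 0"
  proof (rule ccontr)
    assume "P \<noteq> 0"
    let ?n = "op_order P + 2"
    have "op_coeff (P * schroedinger u) ?n = - op_coeff P (op_order P)"
      by (subst top_coeff_mult(2)) (simp_all only: order_below_Suc_op_order order_below_schroedinger,
          simp add: op_coeff_schroedinger)
    moreover have "op_coeff (P * schroedinger u + (op_scalar a * \<partial> + op_scalar b)) ?n = 0"
      unfolding assms by simp
    ultimately have "op_coeff P (op_order P) = 0" by (simp add: op_coeff_del)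
    then show False using \<open>P \<noteq> 0\<close> op_coeff_op_order_nonzero by blast
  qed
  show "a = 0" "b = e"
    using arg_cong [OF assms, of "\<lambda>P. op_coeff P 1"] arg_cong [OF assms, of "\<lambda>P. op_coeff P 0"]
    by (simp_all add: P op_coeff_del)
qed

lemma top_coeff_mult_schroedinger:
  assumes "order_below P (Suc m)"
  shows "order_below (P * schroedinger u) (Suc (m + 2))"
    and "op_coeff (P * schroedinger u) (m + 2) = - op_coeff P m"
  using top_coeff_mult [OF assms order_below_schroedinger [of u]]
  by (simp_all add: op_coeff_schroedinger)

text \<open>The heart of the passage from operators to the KdV hierarchy. If \<open>P = Q L + a \<partial> + b\<close> has the scalar
commutator \<open>- 2 f'\<close>, then uniqueness of the division gives \<open>[L, Q] = - 2 a'\<close>, so the induction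
hypothesis describes \<open>a\<close>, together with \<open>f' = T a\<close>. The leading constant \<open>c 0\<close> is, up to
sign, the coefficient of \<open>P\<close> in order \<open>2 k - 1\<close>.\<close>

lemma kdv_combination_if_scalar_commutator:
  fixes u f :: "'a::{differential_field, field_char_0}"
  assumes "order_below P (2 * k)"
    and "schroedinger u * P - P * schroedinger u = op_scalar (- 2 * der f)"
  shows "\<exists>c. f = kdv_combination u c k \<and> (k > 0 \<and> op_coeff P (2 * k - 1) \<noteq> 0 \<longrightarrow> c 0 \<noteq> 0)"
  using assms
proof (induction k arbitrary: P f)
  case 0
  then have "op_scalar (- 2 * der f) = 0" by (simp add: order_below_0)
  then have "op_coeff (op_scalar (- 2 * der f)) 0 = 0" by (simp only: op_coeff_simps(1))
  then obtain c where "of_const c = f"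
    using constant_of_const by force
  then have "f = kdv_combination u (\<lambda>_. c) 0"
    by (simp add: kdv_combination_0)
  then show ?case by blast
next
  case (Suc k)
  obtain Q a b where P: "P = Q * schroedinger u + (op_scalar a * \<partial> + op_scalar b)"
    and Q: "order_below Q (2 * k)"
    using right_division_schroedinger [of P "2 * k" u] Suc.prems(1) by auto
  note eq = Suc.prems(2) [unfolded P commutator_schroedinger_step]
  note unique = right_division_schroedinger_unique [OF eq]
  have b: "der (der a) + 2 * der b = 0"
    using unique(2) by (simp only: neg_equal_0_iff_equal)
  have f: "der (der b) + a * der u + 2 * der a * u = 2 * der f"
    using unique(3) by (simp only: mult_minus_left neg_equal_iff_equal)
  from unique(1) have "schroedinger u * Q - Q * schroedinger u = op_scalar (- 2 * der a)"
    unfolding mult_minus_left op_scalar_uminus by (simp only: eq_neg_iff_add_eq_0)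
  from Suc.IH [OF Q this] obtain c where c: "a = kdv_combination u c k"
    and c0: "k > 0 \<and> op_coeff Q (2 * k - 1) \<noteq> 0 \<longrightarrow> c 0 \<noteq> 0" by blast
  have "der (der (der a)) + 2 * der (der b) = 0"
    using arg_cong [OF b, of der] by (simp only: mult_2 der_add der_0)
  then have b2: "2 * der (der b) = - der (der (der a))"
    by (metis add.commute eq_neg_iff_add_eq_0)
  have "der f = (2 * (2 * der f)) / 4" by simp
  also have "2 * (2 * der f) = 2 * der (der b) + 2 * (a * der u) + 4 * (der a * u)"
    unfolding f [symmetric] by (simp add: distrib_left)
  also have "\<dots> / 4 = - der (der (der a)) / 4 + u * der a + der u * a / 2"
    unfolding b2 by (simp add: add_divide_distrib)
  also have "\<dots> = der (kdv_combination u c (Suc k))"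
    unfolding der_kdv_combination c ..
  finally have "der (f - kdv_combination u c (Suc k)) = 0"
    by (simp only: der_diff diff_self)
  then obtain d where d: "of_const d = f - kdv_combination u c (Suc k)"
    using constant_of_const by blast
  \<comment> \<open>The constant of integration \<open>d\<close> is absorbed into the coefficient of \<open>v\<^sub>0 = 1\<close>.\<close>
  let ?c = "c(Suc k := c (Suc k) + d)"
  have "kdv_combination u ?c (Suc k) = kdv_combination u c (Suc k) + of_const d"
    by (simp add: kdv_combination_def)
  then have "f = kdv_combination u ?c (Suc k)" using d by simp
  moreover have "?c 0 \<noteq> 0" if "op_coeff P (2 * Suc k - 1) \<noteq> 0"
  proof (cases k)
    case 0
    then have "a = op_coeff P 1"
      using Q by (simp add: P order_below_0 op_coeff_del)
    then show ?thesis using that c 0 by (auto simp: kdv_combination_0)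
  next
    case (Suc m)
    then show ?thesis
      using that c0 top_coeff_mult_schroedinger(2) [of Q "2 * k - 1" u] Q
      by (auto simp: P op_coeff_del)
  qed
  ultimately show ?case by blast
qed

text \<open>The division read backwards: the remainder \<open>a \<partial> - a' / 2\<close> is the one for which the commutator stays a
scalar.\<close>

primrec kdv_operator :: "'a::{differential_field, field_char_0} \<Rightarrow> (nat \<Rightarrow> 'a const) \<Rightarrow> nat \<Rightarrow> 'a diffop" where
  "kdv_operator u c 0 = 0"
| "kdv_operator u c (Suc k) = kdv_operator u c k * schroedinger u
     + (op_scalar (kdv_combination u c k) * \<partial> + op_scalar (- der (kdv_combination u c k) / 2))"

text \<open>If the last combination is a constant, the operator therefore commutes with \<open>L\<close>.\<close>

lemma commutator_kdv_operator:
  "schroedinger u * kdv_operator u c k - kdv_operator u c k * schroedinger u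
    = op_scalar (- 2 * (der (kdv_combination u c k)))"
proof (induction k)
  case 0
  then show ?case by (simp add: kdv_combination_0)
next
  case (Suc k)
  let ?a = "kdv_combination u c k"
  have 1: "op_scalar (- 2 * der ?a) + op_scalar (2 * der ?a) = 0"
    by (intro diffop_eqI) simp
  have 2: "- (der (der ?a) + 2 * der (- der ?a / 2)) = 0"
    by (simp add: der_uminus der_half)
  have 3: "- (der (der (- der ?a / 2)) + ?a * der u + 2 * der ?a * u)
      = - 2 * der (kdv_combination u c (Suc k))"
    unfolding der_kdv_combination by (simp add: der_uminus der_half field_simps)
  show ?case
    unfolding kdv_operator.simps commutator_schroedinger_step Suc.IH 1 2 3 by simp
qed

lemma order_below_kdv_operator: "order_below (kdv_operator u c k) (2 * k)"
proof (induction k)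
  case (Suc k)
  have "order_below (kdv_operator u c k * schroedinger u) (2 * Suc k)"
    using top_coeff_mult_schroedinger(1) [of "kdv_operator u c k" "2 * k - 1" u] Suc
    by (cases k) (auto simp: order_below_def)
  then show ?case by (simp add: order_below_def op_coeff_del)
qed (simp add: order_below_def)

lemma top_coeff_kdv_operator: "op_coeff (kdv_operator u c (Suc k)) (2 * k + 1) = (- 1) ^ k * of_const (c 0)"
proof (induction k)
  case 0
  then show ?case by (simp add: op_coeff_del kdv_combination_0)
next
  case (Suc k)
  have "op_coeff (kdv_operator u c (Suc k) * schroedinger u) (2 * k + 1 + 2)
      = - op_coeff (kdv_operator u c (Suc k)) (2 * k + 1)"
    using order_below_kdv_operator [of u c "Suc k"] by (intro top_coeff_mult_schroedinger) simp
  then show ?case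
    unfolding kdv_operator.simps(2) [of u c "Suc k"] Suc.IH
    by (simp add: op_coeff_del)
qed

section \<open>Commuting operators of odd order and the KdV equations\<close>

definition odd_commuting_order :: "'a::differential_field \<Rightarrow> nat \<Rightarrow> bool" where
  "odd_commuting_order u s \<longleftrightarrow> (\<exists>P \<in> centralizer (schroedinger u). op_order P = 2 * s + 1)"

text \<open>In one direction the combination is divided by its leading constant, which is nonzero because the
order is exactly \<open>2 s + 1\<close>. In the other, the KdV equation says that the commutator of the operator built
from \<open>c\<close> vanishes; since \<open>KdV s c\<close> does not look at \<open>c 0\<close>, that constant can be set to \<open>1\<close>.\<close>

lemma odd_commuting_order_iff_KdV:
  fixes u :: "'a::{differential_field, field_char_0}"
  shows "odd_commuting_order u s \<longleftrightarrow> (\<exists>c. dp_eval u (KdV s c) = 0)"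
proof
  assume "odd_commuting_order u s"
  then obtain P where P: "schroedinger u * P = P * schroedinger u" "op_order P = 2 * s + 1"
    by (auto simp: odd_commuting_order_def centralizer_def)
  have "order_below P (2 * Suc s)"
    using order_below_Suc_op_order [of P] P(2) by simp
  moreover have "schroedinger u * P - P * schroedinger u = op_scalar (- 2 * der 0)"
    using P(1) by simp
  moreover have "P \<noteq> 0" using P(2) by (auto simp: op_order_def zero_diffop.rep_eq)
  then have "op_coeff P (2 * Suc s - 1) \<noteq> 0"
    using op_coeff_op_order_nonzero [of P] P(2) by simp
  ultimately obtain c where c: "kdv_combination u c (Suc s) = 0" "c 0 \<noteq> 0"
    using kdv_combination_if_scalar_commutator [of P "Suc s" u 0] by auto
  have "kdv_combination u (\<lambda>i. c i / c 0) (Suc s) = kdv_combination u c (Suc s) / of_const (c 0)"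
    unfolding kdv_combination_def sum_divide_distrib by simp
  then have "dp_eval u (KdV s (\<lambda>i. c i / c 0)) = 0"
    using c by (simp add: dp_eval_KdV)
  then show "\<exists>c. dp_eval u (KdV s c) = 0" by blast
next
  assume "\<exists>c. dp_eval u (KdV s c) = 0"
  then obtain c where "dp_eval u (KdV s c) = 0" by blast
  moreover have "KdV s c = KdV s (c(0 := 1))"
    unfolding KdV_def by (intro arg_cong2 [of _ _ _ _ plus] sum.cong) auto
  ultimately have "der (kdv_combination u (c(0 := 1)) (Suc s)) = 0"
    using dp_eval_KdV [of "c(0 := 1)" u s] by simp
  then have "kdv_operator u (c(0 := 1)) (Suc s) \<in> centralizer (schroedinger u)"
    using commutator_kdv_operator [of u "c(0 := 1)" "Suc s"] by (simp add: centralizer_def)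
  moreover have "op_order (kdv_operator u (c(0 := 1)) (Suc s)) = 2 * s + 1"
    using order_below_kdv_operator [of u "c(0 := 1)" "Suc s"] top_coeff_kdv_operator [of u "c(0 := 1)" s]
    by (intro op_order_eqI) simp_all
  ultimately show "odd_commuting_order u s"
    unfolding odd_commuting_order_def by blast
qed

section \<open>Polynomials in an operator\<close>

lemma centralizer_add: "P \<in> centralizer L \<Longrightarrow> Q \<in> centralizer L \<Longrightarrow> P + Q \<in> centralizer L"
  by (simp add: centralizer_def distrib_left distrib_right)

lemma centralizer_diff: "P \<in> centralizer L \<Longrightarrow> Q \<in> centralizer L \<Longrightarrow> P - Q \<in> centralizer L"
  by (simp add: centralizer_def left_diff_distrib right_diff_distrib)

lemma centralizer_mult: "P \<in> centralizer L \<Longrightarrow> Q \<in> centralizer L \<Longrightarrow> P * Q \<in> centralizer L"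
  by (simp add: centralizer_def) (metis mult.assoc)

lemma constant_in_centralizer:
  "op_scalar (of_const c) \<in> centralizer (P :: 'a::{differential_field, field_char_0} diffop)"
proof -
  have "op_times p (smult (of_const c) q) = smult (of_const c) (op_times p q)" for p q :: "'a poly"
    by (induction p arbitrary: q)
      (simp_all add: op_times_pCons del_left_smult smult_add_right mult.commute)
  from this [where q = "[:1:]"]
  have "P * op_scalar (of_const c) = op_scalar (of_const c) * P"
    by transfer (simp add: op_times_pCons op_times_1_right)
  then show ?thesis by (simp add: centralizer_def)
qed

lemma self_in_centralizer: "L \<in> centralizer L"
  by (simp add: centralizer_def)

lemma power_in_centralizer: "L ^ k \<in> centralizer L"
  by (simp add: centralizer_def power_commutes)

lemma constant_algebra_in_centralizer:
  assumes "S \<subseteq> centralizer L"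
  shows "constant_algebra S \<subseteq> centralizer (L :: 'a::{differential_field, field_char_0} diffop)"
proof
  show "P \<in> centralizer L" if "P \<in> constant_algebra S" for P
    using that by induction
      (use assms in \<open>auto intro: constant_in_centralizer centralizer_add centralizer_mult\<close>)
qed

lemma power_in_constant_algebra: "P \<in> constant_algebra S \<Longrightarrow> P ^ k \<in> constant_algebra S"
proof (induction k)
  case 0
  show ?case using constant_algebra.scalar [of 1 S] by simp
qed (simp add: constant_algebra.mult)

lemma sum_in_constant_algebra:
  "(\<And>i. i \<in> I \<Longrightarrow> f i \<in> constant_algebra S) \<Longrightarrow> sum f I \<in> constant_algebra S"
proof (induction I rule: infinite_finite_induct)
  case empty
  show ?case using constant_algebra.scalar [of 0 S] by simp
next
  case (infinite I)
  show ?case using constant_algebra.scalar [of 0 S] infinite by simp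
qed (simp add: constant_algebra.add)

lemma poly_at_op_in_constant_algebra: "L \<in> S \<Longrightarrow> poly_at_op p L \<in> constant_algebra S"
  unfolding poly_at_op_def
  by (intro sum_in_constant_algebra constant_algebra.mult constant_algebra.scalar
      power_in_constant_algebra constant_algebra.generator)

lemma poly_at_op_in_centralizer: "poly_at_op p L \<in> centralizer (L :: 'a::{differential_field, field_char_0} diffop)"
  using constant_algebra_in_centralizer [of "{L}" L] poly_at_op_in_constant_algebra [of L "{L}" p]
  by (auto simp: self_in_centralizer)

lemma poly_at_op_0 [simp]: "poly_at_op 0 L = 0"
  by (simp add: poly_at_op_def)

lemma poly_at_op_pCons: "poly_at_op (pCons a p) L = op_scalar (of_const a) + poly_at_op p L * L"
proof (cases "p = 0")
  case False
  then show ?thesis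
    by (simp add: poly_at_op_def sum.atMost_Suc_shift sum_distrib_right mult.assoc
        power_commutes del: sum.atMost_Suc)
qed (simp add: poly_at_op_def)

lemma poly_at_op_add: "poly_at_op (p + q) L = poly_at_op p L + poly_at_op q L"
proof (induction p arbitrary: q)
  case (pCons a p)
  obtain b q' where "q = pCons b q'" by (rule pCons_cases)
  then show ?case
    by (simp add: poly_at_op_pCons pCons.IH op_scalar_add algebra_simps)
qed simp

lemma poly_at_op_diff: "poly_at_op (p - q) L = poly_at_op p L - poly_at_op q L"
  using poly_at_op_add [of "p - q" q L] by simp

lemma poly_at_op_smult: "poly_at_op (smult c p) L = op_scalar (of_const c) * poly_at_op p L"
  by (induction p)
    (simp_all add: poly_at_op_pCons distrib_left op_scalar_mult mult.assoc)

lemma poly_at_op_mult: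
  "poly_at_op (p * q) L = poly_at_op p L * poly_at_op q (L :: 'a::{differential_field, field_char_0} diffop)"
proof (induction p)
  case (pCons a p)
  have "poly_at_op p L * poly_at_op q L * L = poly_at_op p L * L * poly_at_op q L"
    using poly_at_op_in_centralizer [of q L] by (simp add: centralizer_def mult.assoc)
  then show ?case
    by (simp add: poly_at_op_pCons poly_at_op_add poly_at_op_smult pCons.IH distrib_right)
qed simp

lemma poly_at_op_commute:
  assumes "B \<in> centralizer (L :: 'a::{differential_field, field_char_0} diffop)"
  shows "B * poly_at_op p L = poly_at_op p L * B"
proof -
  have "constant_algebra {L} \<subseteq> centralizer B"
    using assms by (intro constant_algebra_in_centralizer) (simp add: centralizer_def)
  then show ?thesis
    using poly_at_op_in_constant_algebra [of L "{L}" p] by (auto simp: centralizer_def)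
qed

lemma constant_algebra_singleton:
  "constant_algebra {L} = range (\<lambda>p. poly_at_op p (L :: 'a::{differential_field, field_char_0} diffop))"
proof
  show "constant_algebra {L} \<subseteq> range (\<lambda>p. poly_at_op p L)"
  proof
    show "P \<in> range (\<lambda>p. poly_at_op p L)" if "P \<in> constant_algebra {L}" for P
      using that
    proof induction
      case (scalar c)
      have "op_scalar (of_const c) = poly_at_op [:c:] L" by (simp add: poly_at_op_pCons)
      then show ?case by blast
    next
      case (generator P)
      then have "P = poly_at_op [:0, 1:] L" by (simp add: poly_at_op_pCons)
      then show ?case by blast
    next
      case (add P Q)
      then show ?case by (auto simp flip: poly_at_op_add)
    next
      case (mult P Q)
      then show ?case by (auto simp flip: poly_at_op_mult)
    qed
  qed
qed (auto intro: poly_at_op_in_constant_algebra)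

lemma op_order_poly_at_schroedinger:
  fixes u :: "'a::{differential_field, field_char_0}"
  shows "op_order (poly_at_op p (schroedinger u)) = 2 * degree p"
    and "p \<noteq> 0 \<Longrightarrow> poly_at_op p (schroedinger u) \<noteq> 0"
proof -
  have "poly_at_op p (schroedinger u) \<noteq> 0 \<and> op_order (poly_at_op p (schroedinger u)) = 2 * degree p"
    if "p \<noteq> 0" for p
    using that
  proof (induction p)
    case (pCons a p)
    show ?case
    proof (cases "p = 0")
      case True
      then have "of_const a \<noteq> 0" using pCons.hyps
        by (metis of_const_inject of_const_simps(1))
      then have "op_order (op_scalar (of_const a)) = 0" "op_scalar (of_const a) \<noteq> 0"
        by (auto intro!: op_order_eqI simp: order_below_def dest!: arg_cong [of _ _ "\<lambda>P. op_coeff P 0"])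
      then show ?thesis using True by (simp add: poly_at_op_pCons)
    next
      case False
      let ?Q = "poly_at_op p (schroedinger u) * schroedinger u"
      have Q: "op_order ?Q = 2 * degree p + 2"
        using False pCons.IH by (simp add: op_order_mult op_order_schroedinger)
      have "op_order (op_scalar (of_const a)) < op_order ?Q"
        unfolding Q by (simp add: op_order_def op_scalar.rep_eq)
      then have "op_order (op_scalar (of_const a) + ?Q) = 2 * degree p + 2"
        using Q by (simp add: op_order_add_less)
      then show ?thesis using False by (auto simp: poly_at_op_pCons)
    qed
  qed simp
  then show "op_order (poly_at_op p (schroedinger u)) = 2 * degree p"
    and "p \<noteq> 0 \<Longrightarrow> poly_at_op p (schroedinger u) \<noteq> 0"
    by (cases "p = 0"; simp)+
qed

section \<open>The structure of the centralizer\<close>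

text \<open>For \<open>P\<close> of order \<open>n\<close>, the coefficient of \<open>[L, P]\<close> in order \<open>n + 1\<close> is \<open>- 2\<close> times the derivative of the
leading coefficient.\<close>

lemma top_coeff_centralizer_schroedinger:
  assumes "P \<in> centralizer (schroedinger (u :: 'a::{differential_field, field_char_0}))"
  shows "der (op_coeff P (op_order P)) = 0"
proof -
  let ?n = "op_order P"
  have z: "op_coeff P (Suc ?n) = 0"
    using order_below_Suc_op_order [of P] by (simp add: order_below_def)
  have "order_below (op_scalar u) (Suc 0)" by (simp add: order_below_def)
  from top_coeff_mult(1) [OF order_below_Suc_op_order [of P] this]
  have zu: "op_coeff (P * op_scalar u) (Suc ?n) = 0"
    by (simp add: order_below_def)
  have "P * schroedinger u = P * op_scalar u - P * \<partial> * \<partial>"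
    by (simp add: schroedinger_def power2_eq_square algebra_simps)
  then have "op_coeff (op_scalar u * P - \<partial> * (\<partial> * P)) (Suc ?n)
      = op_coeff (P * op_scalar u - P * \<partial> * \<partial>) (Suc ?n)"
    using assms by (simp add: centralizer_def schroedinger_mult)
  then have "der (op_coeff P ?n) + der (op_coeff P ?n) = 0"
    using z zu by (simp add: op_coeff_del_mult op_coeff_mult_del der_add split: nat.splits)
  then show ?thesis by simp
qed

lemma cancel_top_coeff:
  fixes u :: "'a::{differential_field, field_char_0}"
  assumes "P \<in> centralizer (schroedinger u)" "B \<in> centralizer (schroedinger u)"
    and "B \<noteq> 0" "op_order B = op_order P"
  shows "\<exists>c. order_below (P - op_scalar (of_const c) * B) (op_order P)"
proof -
  let ?n = "op_order P"
  have B: "op_coeff B ?n \<noteq> 0" using assms(3,4) op_coeff_op_order_nonzero by metis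
  obtain p b where pb: "of_const p = op_coeff P ?n" "of_const b = op_coeff B ?n"
    using top_coeff_centralizer_schroedinger [OF assms(1)] top_coeff_centralizer_schroedinger [OF assms(2)]
      constant_of_const assms(4) by metis
  have "op_coeff (P - op_scalar (of_const (p / b)) * B) i = 0" if "i \<ge> ?n" for i
  proof (cases "i = ?n")
    case True
    then show ?thesis using pb B by simp
  next
    case False
    then show ?thesis
      using that order_below_Suc_op_order [of P] order_below_Suc_op_order [of B] assms(4)
      by (simp add: order_below_def)
  qed
  then show ?thesis unfolding order_below_def by blast
qed

text \<open>Descent on the order by cancelling leading terms: an additively closed set contains all elements of the
centralizer of order below \<open>n\<close> if it contains the constant multiples of one element for each order that
occurs.\<close>

lemma centralizer_induct:
  fixes u :: "'a::{differential_field, field_char_0}"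
  assumes zero: "0 \<in> M"
    and add: "\<And>P Q. P \<in> M \<Longrightarrow> Q \<in> M \<Longrightarrow> P + Q \<in> M"
    and realize: "\<And>P. P \<in> centralizer (schroedinger u) \<Longrightarrow> P \<noteq> 0 \<Longrightarrow> op_order P < n \<Longrightarrow>
      \<exists>B \<in> centralizer (schroedinger u). B \<noteq> 0 \<and> op_order B = op_order P \<and>
        (\<forall>c. op_scalar (of_const c) * B \<in> M)"
    and P: "P \<in> centralizer (schroedinger u)" "order_below P n"
  shows "P \<in> M"
proof -
  have "P \<in> M" if "P \<in> centralizer (schroedinger u)" "order_below P m" "m \<le> n" for P m
    using that
  proof (induction m arbitrary: P rule: less_induct)
    case (less m)
    show ?case
    proof (cases "P = 0")
      case False
      have ord: "op_order P < m" using False less.prems op_order_less by blast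
      then obtain B where B: "B \<in> centralizer (schroedinger u)" "B \<noteq> 0" "op_order B = op_order P"
        "\<forall>c. op_scalar (of_const c) * B \<in> M"
        using realize [OF less.prems(1) False] less.prems(3) by auto
      obtain c where c: "order_below (P - op_scalar (of_const c) * B) (op_order P)"
        using cancel_top_coeff [OF less.prems(1) B(1-3)] by blast
      have "P - op_scalar (of_const c) * B \<in> M"
        using ord less.prems c
        by (intro less.IH [of "op_order P"] centralizer_diff centralizer_mult
            constant_in_centralizer B) auto
      from add [OF this B(4) [rule_format, of c]] show ?thesis by simp
    qed (simp add: zero)
  qed
  then show ?thesis using P by blast
qed

lemma schroedinger_power: "schroedinger u ^ k \<noteq> 0 \<and> op_order (schroedinger u ^ k) = 2 * k"
proof (induction k)
  case 0
  have "op_order (1 :: 'a diffop) = 0" by (simp add: op_order_def one_diffop.rep_eq)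
  then show ?case by simp
qed (simp add: op_order_mult op_order_schroedinger)

lemma poly_at_op_monom: "poly_at_op (monom c k) L = op_scalar (of_const c) * L ^ k"
  by (induction k) (simp_all add: monom_0 monom_Suc poly_at_op_pCons power_commutes mult.assoc)

text \<open>Below the least odd order all orders are even, and powers of \<open>L\<close> realize all even orders.\<close>

lemma low_order_centralizer:
  fixes u :: "'a::{differential_field, field_char_0}"
  assumes least: "\<forall>t<s. \<not> odd_commuting_order u t"
    and P: "P \<in> centralizer (schroedinger u)" "op_order P < 2 * s + 1"
  shows "P \<in> constant_algebra {schroedinger u}"
proof (rule centralizer_induct [where n = "2 * s + 1", OF _ _ _ P(1)])
  show "order_below P (2 * s + 1)"
    using P(2) by (auto intro: order_below_mono [OF order_below_Suc_op_order])
  show "0 \<in> constant_algebra {schroedinger u}"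
    using poly_at_op_in_constant_algebra [of "schroedinger u" "{schroedinger u}" 0] by simp
next
  fix Q assume Q: "Q \<in> centralizer (schroedinger u)" "op_order Q < 2 * s + 1"
  have "even (op_order Q)"
  proof (rule ccontr)
    assume "odd (op_order Q)"
    then obtain t where "op_order Q = 2 * t + 1" by (auto elim: oddE)
    then show False using Q least by (auto simp: odd_commuting_order_def)
  qed
  then obtain k where "op_order Q = 2 * k" by (auto elim: evenE)
  then show "\<exists>B \<in> centralizer (schroedinger u). B \<noteq> 0 \<and> op_order B = op_order Q \<and>
        (\<forall>c. op_scalar (of_const c) * B \<in> constant_algebra {schroedinger u})"
    by (intro bexI [of _ "schroedinger u ^ k"])
      (simp_all add: schroedinger_power power_in_centralizer constant_algebra.intros
        power_in_constant_algebra)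
qed (rule constant_algebra.add)

text \<open>The centralizer is \<open>C[L] + C[L] A\<close>: even orders are realized by powers of \<open>L\<close>, and an odd order is
at least that of \<open>A\<close>, so that it is realized by some \<open>L\<^sup>k A\<close>.\<close>

lemma centralizer_decomposition:
  fixes u :: "'a::{differential_field, field_char_0}"
  assumes least: "\<forall>t<s. \<not> odd_commuting_order u t"
    and A: "A \<in> centralizer (schroedinger u)" "op_order A = 2 * s + 1"
    and P: "P \<in> centralizer (schroedinger u)"
  shows "\<exists>p q. P = poly_at_op p (schroedinger u) + poly_at_op q (schroedinger u) * A"
proof -
  let ?L = "schroedinger u"
  let ?M = "{poly_at_op p ?L + poly_at_op q ?L * A | p q. True}"
  have "P \<in> ?M"
  proof (rule centralizer_induct [OF _ _ _ P order_below_Suc_op_order])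
    have "poly_at_op 0 ?L + poly_at_op 0 ?L * A \<in> ?M" by blast
    then show "0 \<in> ?M" by simp
  next
    fix P Q assume "P \<in> ?M" "Q \<in> ?M"
    then obtain p q p' q' where "P = poly_at_op p ?L + poly_at_op q ?L * A"
      "Q = poly_at_op p' ?L + poly_at_op q' ?L * A" by blast
    then have "P + Q = poly_at_op (p + p') ?L + poly_at_op (q + q') ?L * A"
      by (simp add: poly_at_op_add algebra_simps)
    then show "P + Q \<in> ?M" by blast
  next
    fix Q assume Q: "Q \<in> centralizer ?L"
    show "\<exists>B \<in> centralizer ?L. B \<noteq> 0 \<and> op_order B = op_order Q \<and>
        (\<forall>c. op_scalar (of_const c) * B \<in> ?M)"
    proof (cases "even (op_order Q)")
      case True
      then obtain k where k: "op_order Q = 2 * k" by (auto elim: evenE)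
      have "op_scalar (of_const c) * ?L ^ k = poly_at_op (monom c k) ?L + poly_at_op 0 ?L * A" for c
        by (simp add: poly_at_op_monom)
      then have "op_scalar (of_const c) * ?L ^ k \<in> ?M" for c by blast
      then show ?thesis
        by (intro bexI [of _ "?L ^ k"]) (simp_all add: schroedinger_power power_in_centralizer k)
    next
      case False
      then obtain t where t: "op_order Q = 2 * t + 1" by (auto elim: oddE)
      have "\<not> t < s" using least Q t by (auto simp: odd_commuting_order_def)
      then have k: "2 * (t - s) + (2 * s + 1) = op_order Q" using t by simp
      have "op_scalar (of_const c) * (?L ^ (t - s) * A)
          = poly_at_op 0 ?L + poly_at_op (monom c (t - s)) ?L * A" for c
        by (simp add: poly_at_op_monom mult.assoc)
      then have "op_scalar (of_const c) * (?L ^ (t - s) * A) \<in> ?M" for c by blast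
      moreover have "A \<noteq> 0" using A(2) by auto
      then have "op_order (?L ^ (t - s) * A) = op_order Q" "?L ^ (t - s) * A \<noteq> 0"
        using k A(2) by (simp_all add: op_order_mult schroedinger_power)
      ultimately show ?thesis
        by (intro bexI [of _ "?L ^ (t - s) * A"] centralizer_mult power_in_centralizer A) simp_all
    qed
  qed
  then show ?thesis by blast
qed

lemma op_order_constant_algebra_even:
  fixes u :: "'a::{differential_field, field_char_0}"
  shows "P \<in> constant_algebra {schroedinger u} \<Longrightarrow> even (op_order P)"
  by (auto simp: constant_algebra_singleton op_order_poly_at_schroedinger)

text \<open>Start from any monic \<open>B\<close> of order \<open>2 s + 1\<close>, write \<open>B\<^sup>2 = p(L) + q(L) B\<close> and complete the square:
\<open>A = B - q(L) / 2\<close>. The correction must not disturb the leading term, and indeed \<open>q\<close> has degree at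
most \<open>s\<close>: the two summands of \<open>B\<^sup>2\<close> have orders of different parity, so their leading terms cannot
cancel, and \<open>B\<^sup>2\<close> has order \<open>4 s + 2\<close>.\<close>

lemma square_root_in_centralizer:
  fixes u :: "'a::{differential_field, field_char_0}"
  assumes least: "\<forall>t<s. \<not> odd_commuting_order u t" and "odd_commuting_order u s"
  shows "\<exists>A R. A \<in> centralizer (schroedinger u) \<and> op_monic A \<and> op_order A = 2 * s + 1 \<and>
    degree R = 2 * s + 1 \<and> A ^ 2 + poly_at_op R (schroedinger u) = 0"
proof -
  let ?L = "schroedinger u"
  let ?n = "2 * s + 1"
  obtain P where P: "P \<in> centralizer ?L" "op_order P = ?n"
    using assms(2) by (auto simp: odd_commuting_order_def)
  have "P \<noteq> 0" using P(2) by auto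
  then have P0: "op_coeff P ?n \<noteq> 0"
    using op_coeff_op_order_nonzero [of P] P(2) by simp
  obtain c where c: "of_const c = op_coeff P ?n"
    using top_coeff_centralizer_schroedinger [OF P(1)] P(2) constant_of_const by auto
  define B where "B = op_scalar (of_const (1 / c)) * P"
  have B: "B \<in> centralizer ?L"
    unfolding B_def by (intro centralizer_mult constant_in_centralizer P)
  have B_below: "order_below B (Suc ?n)"
    using order_below_Suc_op_order [of P] unfolding P(2) by (simp add: B_def order_below_def)
  have B_top: "op_coeff B ?n = 1"
    using P0 c by (simp add: B_def)
  have B_order: "op_order B = ?n"
    using B_below B_top by (intro op_order_eqI) simp_all
  have "B * B \<in> centralizer ?L" by (intro centralizer_mult B)
  then obtain p q where pq: "B * B = poly_at_op p ?L + poly_at_op q ?L * B"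
    using centralizer_decomposition [OF least B B_order] by blast
  have "B \<noteq> 0" using B_order by auto
  then have BB: "op_order (B * B) = 4 * s + 2" by (simp add: op_order_mult B_order)
  have q: "degree q \<le> s"
  proof (cases "q = 0")
    case False
    have odd: "op_order (poly_at_op q ?L * B) = 2 * degree q + ?n"
      using False \<open>B \<noteq> 0\<close> by (simp add: op_order_mult op_order_poly_at_schroedinger B_order)
    show ?thesis
    proof (rule ccontr)
      assume "\<not> degree q \<le> s"
      have "op_order (poly_at_op p ?L) \<noteq> op_order (poly_at_op q ?L * B)"
        unfolding odd op_order_poly_at_schroedinger by presburger
      then have "op_order (B * B) \<ge> op_order (poly_at_op q ?L * B)"
        unfolding pq using op_order_add_less [of "poly_at_op p ?L" "poly_at_op q ?L * B"]
          op_order_add_less [of "poly_at_op q ?L * B" "poly_at_op p ?L"]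
        by (metis add.commute linorder_neq_iff nat_less_le order_refl)
      then show False using \<open>\<not> degree q \<le> s\<close> unfolding odd BB by linarith
    qed
  qed simp
  define h where "h = smult (1 / 2) q"
  have h: "q = h + h" by (simp add: h_def flip: smult_add_left)
  let ?H = "poly_at_op h ?L"
  have H_order: "op_order ?H < ?n"
    using q by (simp add: op_order_poly_at_schroedinger h_def)
  have commute: "B * ?H = ?H * B"
    using B by (rule poly_at_op_commute)
  define A where "A = B - ?H"
  have A: "A \<in> centralizer ?L"
    unfolding A_def by (intro centralizer_diff B poly_at_op_in_centralizer)
  have "op_order (- ?H) < op_order B" using H_order B_order by simp
  then have "op_order (- ?H + B) = op_order B" by (rule op_order_add_less)
  then have A_order: "op_order A = ?n" by (simp add: A_def B_order)
  have "op_coeff ?H ?n = 0"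
    using H_order order_below_Suc_op_order [of ?H] by (simp add: order_below_def)
  then have monic: "op_monic A"
    unfolding op_monic_def A_order using B_top by (simp add: A_def)
  have "A ^ 2 = B * B - (?H + ?H) * B + ?H * ?H"
    by (simp add: A_def power2_eq_square commute algebra_simps)
  also have "\<dots> = poly_at_op (p + h * h) ?L"
    unfolding pq h poly_at_op_add poly_at_op_mult by (simp add: algebra_simps)
  finally have A2: "A ^ 2 = poly_at_op (p + h * h) ?L" .
  define R where "R = - (p + h * h)"
  have "poly_at_op (p + h * h) ?L + poly_at_op R ?L = poly_at_op (p + h * h + R) ?L"
    by (simp only: poly_at_op_add)
  then have "A ^ 2 + poly_at_op R ?L = 0"
    unfolding A2 R_def by (simp only: right_minus poly_at_op_0)
  moreover have "A \<noteq> 0" using A_order by auto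
  then have "op_order (A ^ 2) = 2 * ?n"
    by (simp add: power2_eq_square op_order_mult A_order)
  then have "degree R = ?n"
    unfolding A2 op_order_poly_at_schroedinger by (simp add: R_def del: minus_add_distrib)
  ultimately show ?thesis using A A_order monic by blast
qed

lemma centralizer_generated:
  fixes u :: "'a::{differential_field, field_char_0}"
  assumes "\<forall>t<s. \<not> odd_commuting_order u t"
    and A: "A \<in> centralizer (schroedinger u)" "op_order A = 2 * s + 1"
  shows "centralizer (schroedinger u) = constant_algebra {schroedinger u, A}"
proof
  show "centralizer (schroedinger u) \<subseteq> constant_algebra {schroedinger u, A}"
  proof
    fix P assume "P \<in> centralizer (schroedinger u)"
    then obtain p q where "P = poly_at_op p (schroedinger u) + poly_at_op q (schroedinger u) * A"
      using centralizer_decomposition assms by blast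
    then show "P \<in> constant_algebra {schroedinger u, A}"
      by (simp add: constant_algebra.intros poly_at_op_in_constant_algebra)
  qed
  show "constant_algebra {schroedinger u, A} \<subseteq> centralizer (schroedinger u)"
    using A by (intro constant_algebra_in_centralizer) (simp add: self_in_centralizer)
qed

lemma basic_operator_exists:
  fixes u :: "'a::{differential_field, field_char_0}"
  assumes "odd_commuting_order u s" and least: "\<forall>t<s. \<not> odd_commuting_order u t"
  shows "\<exists>A. basic_operator (schroedinger u) s A"
proof -
  obtain A R where A: "A \<in> centralizer (schroedinger u)" "op_monic A" "op_order A = 2 * s + 1"
    "degree R = 2 * s + 1" "A ^ 2 + poly_at_op R (schroedinger u) = 0"
    using square_root_in_centralizer [OF least assms(1)] by blast
  have "A \<notin> constant_algebra {schroedinger u}"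
    using op_order_constant_algebra_even [of A u] A(3) by auto
  moreover have "op_order A \<le> op_order B"
    if "B \<in> centralizer (schroedinger u) - constant_algebra {schroedinger u}" for B
    using low_order_centralizer [OF least, of B] that A(3) by force
  ultimately have "minimal_order_in_centralizer (schroedinger u) A"
    using A(1) by (simp add: minimal_order_in_centralizer_def)
  then have "basic_operator (schroedinger u) s A"
    using A centralizer_generated [OF least A(1,3)] by (auto simp: basic_operator_def)
  then show ?thesis ..
qed

lemma odd_commuting_order_if_basic_operator:
  fixes u :: "'a::{differential_field, field_char_0}"
  assumes "basic_operator (schroedinger u) s A"
  shows "odd_commuting_order u s" and "\<forall>t<s. \<not> odd_commuting_order u t"
proof -
  have A: "op_order A = 2 * s + 1" "A \<in> centralizer (schroedinger u)"
    and min: "\<And>B. B \<in> centralizer (schroedinger u) - constant_algebra {schroedinger u} \<Longrightarrow> op_order A \<le> op_order B"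
    using assms by (auto simp: basic_operator_def minimal_order_in_centralizer_def)
  show "odd_commuting_order u s" using A by (auto simp: odd_commuting_order_def)
  show "\<forall>t<s. \<not> odd_commuting_order u t"
  proof (intro allI impI notI)
    fix t assume "t < s" "odd_commuting_order u t"
    then obtain P where P: "P \<in> centralizer (schroedinger u)" "op_order P = 2 * t + 1"
      by (auto simp: odd_commuting_order_def)
    then have "P \<notin> constant_algebra {schroedinger u}"
      using op_order_constant_algebra_even [of P u] by auto
    then show False using min [of P] P A \<open>t < s\<close> by auto
  qed
qed

text \<open>Two such operators differ by an element \<open>p(L)\<close> of lower order. Comparing squares,
\<open>2 p(L) B\<close> lies in \<open>C[L]\<close>, whose elements have even order; but it has odd order unless \<open>p = 0\<close>.\<close>

lemma basic_operator_unique: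
  fixes u :: "'a::{differential_field, field_char_0}"
  assumes "basic_operator (schroedinger u) s A" "basic_operator (schroedinger u) s B"
  shows "A = B"
proof (rule ccontr)
  assume "A \<noteq> B"
  let ?L = "schroedinger u"
  obtain R S where A: "A \<in> centralizer ?L" "op_order A = 2 * s + 1" "op_coeff A (2 * s + 1) = 1"
      "A ^ 2 + poly_at_op R ?L = 0"
    and B: "B \<in> centralizer ?L" "op_order B = 2 * s + 1" "op_coeff B (2 * s + 1) = 1"
      "B ^ 2 + poly_at_op S ?L = 0"
    using assms by (auto simp: basic_operator_def op_monic_def minimal_order_in_centralizer_def)
  have "op_coeff (A - B) i = 0" if "i \<ge> 2 * s + 1" for i
    using that A(3) B(3) order_below_Suc_op_order [of A] order_below_Suc_op_order [of B]
    unfolding A(2) B(2) order_below_def by (cases "i = 2 * s + 1") auto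
  then have "op_order (A - B) < 2 * s + 1"
    using \<open>A \<noteq> B\<close> by (intro op_order_less) (auto simp: order_below_def)
  then have "A - B \<in> constant_algebra {?L}"
    by (intro low_order_centralizer [OF odd_commuting_order_if_basic_operator(2) [OF assms(1)]]
        centralizer_diff A B)
  then obtain p where "A - B = poly_at_op p ?L"
    by (auto simp: constant_algebra_singleton)
  then have AB: "A = B + poly_at_op p ?L" by (simp add: algebra_simps)
  then have p: "p \<noteq> 0" using \<open>A \<noteq> B\<close> by auto
  have commute: "B * poly_at_op p ?L = poly_at_op p ?L * B"
    using B(1) by (rule poly_at_op_commute)
  have "A ^ 2 = B ^ 2 + poly_at_op (p + p) ?L * B + poly_at_op (p * p) ?L"
    unfolding AB poly_at_op_add poly_at_op_mult
    by (simp add: power2_eq_square commute algebra_simps)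
  moreover have "A ^ 2 = - poly_at_op R ?L" "B ^ 2 = - poly_at_op S ?L"
    using A(4) B(4) by (simp_all add: eq_neg_iff_add_eq_0)
  ultimately have "poly_at_op (p + p) ?L * B = poly_at_op (S - R - p * p) ?L"
    unfolding poly_at_op_diff by (simp add: algebra_simps)
  then have "even (op_order (poly_at_op (p + p) ?L * B))"
    by (simp only: op_order_poly_at_schroedinger) simp
  moreover have "p + p \<noteq> 0"
    using p by (simp flip: smult_add_left [of 1 1, simplified])
  then have "op_order (poly_at_op (p + p) ?L * B) = 2 * degree (p + p) + (2 * s + 1)"
    using B(2) by (subst op_order_mult) (auto simp: op_order_poly_at_schroedinger)
  ultimately show False by simp
qed

section \<open>The equivalence\<close>

theorem theoremA:
  fixes u :: "'a::{differential_field, field_char_0}"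
  assumes alg_closed: "\<And>p :: 'a const poly. degree p > 0 \<Longrightarrow> \<exists>c. poly p c = 0"
    and nonconstant: "u \<notin> constants"
  shows "(algebro_geometric (schroedinger u) \<longleftrightarrow>
            (\<exists>s. \<exists>!A. basic_operator (schroedinger u) s A)) \<and>
         (algebro_geometric (schroedinger u) \<longleftrightarrow> (\<exists>s. KdV_potential u s)) \<and>
         (\<forall>s. (\<exists>!A. basic_operator (schroedinger u) s A) \<longleftrightarrow> KdV_potential u s)"
proof -
  have KdV: "KdV_potential u s \<longleftrightarrow> odd_commuting_order u s \<and> (\<forall>t<s. \<not> odd_commuting_order u t)" for s
    by (simp add: KdV_potential_def odd_commuting_order_iff_KdV)
  have basic: "(\<exists>!A. basic_operator (schroedinger u) s A) \<longleftrightarrow> KdV_potential u s" for s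
    unfolding KdV
    using basic_operator_exists basic_operator_unique odd_commuting_order_if_basic_operator by metis
  have "op_coeff (schroedinger u) 0 \<notin> constants"
    using nonconstant by (simp add: op_coeff_schroedinger)
  then have "schroedinger u \<notin> constant_coeff_ops"
    by (auto simp: constant_coeff_ops_def)
  then have "algebro_geometric (schroedinger u) \<longleftrightarrow>
      (\<exists>P. P \<noteq> 0 \<and> odd (op_order P) \<and> P \<in> centralizer (schroedinger u))"
    by (simp add: algebro_geometric_def centralizer_def op_order_schroedinger)
  also have "\<dots> \<longleftrightarrow> (\<exists>s. odd_commuting_order u s)"
  proof
    assume "\<exists>P. P \<noteq> 0 \<and> odd (op_order P) \<and> P \<in> centralizer (schroedinger u)"
    then show "\<exists>s. odd_commuting_order u s"
      unfolding odd_commuting_order_def by (blast elim: oddE)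
  next
    assume "\<exists>s. odd_commuting_order u s"
    then obtain P s where P: "P \<in> centralizer (schroedinger u)" "op_order P = 2 * s + 1"
      by (auto simp: odd_commuting_order_def)
    moreover have "P \<noteq> 0" using P(2) by auto
    ultimately show "\<exists>P. P \<noteq> 0 \<and> odd (op_order P) \<and> P \<in> centralizer (schroedinger u)"
      by (intro exI [of _ P]) simp
  qed
  also have "\<dots> \<longleftrightarrow> (\<exists>s. KdV_potential u s)"
    unfolding KdV using exists_least_iff [of "odd_commuting_order u"] by blast
  finally show ?thesis using basic by blast
qed

end
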